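(* Assume that the equation $$u_{tt}+(\mathcal A_0+\theta_1\mathcal A_1)u=(\mathcal B_0+\theta_2\mathcal B_1)u_t+\dot W,\quad 0<t\le T,\qquad u(0)=u_t(0)=0,$$ is diagonalizable and hyperbolic on $[0,T]$. Then there is a unique adapted $X$-valued process $u=u(t)$, $t\in[0,T]$, with the representation $u(t)=\sum_{k\ge1}u_k(t)h_k$, where $$\ddot u_k(t)-(\rho_k+\theta_2\nu_k)\dot u_k(t)+(\kappa_k+\theta_1\tau_k)u_k(t)=\dot w_k(t),\qquad u_k(0)=\dot u_k(0)=0,\quad k\ge1.$$ If, in addition, there exists a real number $C_0$ such that $\theta_2\nu_k+\rho_k\le C_0$ for all $k$, then $v(t)=\dot u(t)=\sum_{k\ge1}\dot u_k(t)h_k$ is also an $X$-valued process.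
   Context: Setting. $H$ is a separable Hilbert space with orthonormal basis $\{h_k,\ k\ge1\}$; $X$ is a separable Hilbert space such that $H$ is densely and continuously embedded into $X$ and $\sum_{k\ge1}\|h_k\|_X^2<\infty$; $\mathcal A_0,\mathcal A_1,\mathcal B_0,\mathcal B_1$ are linear operators on $H$; $\Theta_1,\Theta_2\subset\mathbb R$ are compact sets, $\theta_1\in\Theta_1$, $\theta_2\in\Theta_2$; $T>0$ is fixed and non-random; $(\Omega,\mathcal F,\{\mathcal F_t\}_{t\ge0},\mathbb P)$ is a stochastic basis with the usual assumptions carrying independent standard Brownian motions $w_k$, $k\ge1$; $W(t)=\sum_{k\ge1}h_kw_k(t)$ is a cylindrical Brownian motion on $H$. Diagonalizable: the four operators have the common system of eigenfunctions $\{h_k\}$: $\mathcal A_0h_k=\kappa_kh_k$, $\mathcal A_1h_k=\tau_kh_k$, $\mathcal B_0h_k=\rho_kh_k$, $\mathcal B_1h_k=\nu_kh_k$. Write $\lambda_k(\theta)=\kappa_k+\theta\tau_k$, $\mu_k(\theta)=\rho_k+\theta\nu_k$. Hyperbolic on $[0,T]$: (i) there are positive numbers $C^*,c_1,c_2$ such that for every $\theta\in\Theta_1$ the sequence $\{\lambda_k(\theta)+C^*,\ k\ge1\}$ is positive, non-decreasing and unbounded, and $c_1\le\frac{\lambda_k(\theta)+C^*}{\lambda_k(\theta')+C^*}\le c_2$ for all $k\geq 1$ and all $\theta,\theta'\in\Theta_1$; (ii) there are positive numbers $C,J$ such that $T\mu_k(\theta_2)\le\ln\lambda_k(\theta_1)+C$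 for all $k\ge J$, $\theta_1\in\Theta_1$, $\theta_2\in\Theta_2$. The second-order equation for $u_k$ is understood as: $u_k(t)=\int_0^tv_k(s)\,ds$ and $dv_k=(-\lambda_k(\theta_1)u_k+\mu_k(\theta_2)v_k)\,dt+dw_k$, $v_k(0)=0$, with $\dot u_k=v_k$. The process $u$ (the "generalized solution") is $X$-valued in the sense that for each $t\in[0,T]$ the series $\sum_ku_k(t)h_k$ converges in $X$ in mean square, and similarly for $v$. *)

theory Defs
  imports "HOL-Probability.Probability"
begin

section \<open>Operators and structural conditions\<close>

text \<open>A linear operator on a Hilbert space is a domain together with a map whose values outside
  the domain are irrelevant; the operators of the equation are unbounded in general. All sequences
  are indexed from \<open>0\<close>, so \<open>h k\<close> is the \<open>(k+1)\<close>-st basis vector of the usual enumeration.\<close>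

type_synonym 'h operator = "'h set \<times> ('h \<Rightarrow> 'h)"

definition linear_operator :: "'h::real_vector operator \<Rightarrow> bool" where
  "linear_operator A \<longleftrightarrow> subspace (fst A) \<and>
     (\<forall>x\<in>fst A. \<forall>y\<in>fst A. snd A (x + y) = snd A x + snd A y) \<and>
     (\<forall>c. \<forall>x\<in>fst A. snd A (c *\<^sub>R x) = c *\<^sub>R snd A x)"

definition orthonormal_basis :: "(nat \<Rightarrow> 'h::real_inner) \<Rightarrow> bool" where
  "orthonormal_basis h \<longleftrightarrow>
     (\<forall>j k. inner (h j) (h k) = (if j = k then 1 else 0)) \<and> closure (span (range h)) = UNIV"

definition dense_embedding :: "('h::real_normed_vector \<Rightarrow> 'x::real_normed_vector) \<Rightarrow> bool" where
  "dense_embedding \<iota> \<longleftrightarrow> bounded_linear \<iota> \<and> inj \<iota> \<and> closure (range \<iota>) = UNIV"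

definition eigen_system :: "(nat \<Rightarrow> 'h::real_vector) \<Rightarrow> 'h operator \<Rightarrow> (nat \<Rightarrow> real) \<Rightarrow> bool" where
  "eigen_system h A e \<longleftrightarrow> (\<forall>k. h k \<in> fst A \<and> snd A (h k) = e k *\<^sub>R h k)"

definition diagonalizable ::
  "(nat \<Rightarrow> 'h::real_vector) \<Rightarrow> 'h operator \<Rightarrow> 'h operator \<Rightarrow> 'h operator \<Rightarrow> 'h operator \<Rightarrow>
   (nat \<Rightarrow> real) \<Rightarrow> (nat \<Rightarrow> real) \<Rightarrow> (nat \<Rightarrow> real) \<Rightarrow> (nat \<Rightarrow> real) \<Rightarrow> bool" where
  "diagonalizable h A0 A1 B0 B1 \<kappa> \<tau> \<rho> \<nu> \<longleftrightarrow>
     eigen_system h A0 \<kappa> \<and> eigen_system h A1 \<tau> \<and> eigen_system h B0 \<rho> \<and> eigen_system h B1 \<nu>"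

text \<open>\<open>eig \<kappa> \<tau> \<theta> k\<close> is \<open>\<lambda>\<^sub>k(\<theta>)\<close>, and \<open>eig \<rho> \<nu> \<theta> k\<close> is \<open>\<mu>\<^sub>k(\<theta>)\<close>.\<close>

definition eig :: "(nat \<Rightarrow> real) \<Rightarrow> (nat \<Rightarrow> real) \<Rightarrow> real \<Rightarrow> nat \<Rightarrow> real" where
  "eig a b \<theta> k = a k + \<theta> * b k"

text \<open>The conjunct \<open>0 < eig \<kappa> \<tau> \<theta>1 k\<close> makes explicit that the logarithm has to make sense. For
  nonempty \<open>\<Theta>1\<close> it only affects the choice of \<open>J\<close>: by the first part, the \<open>\<lambda>\<^sub>k(\<theta>)\<close> are eventually
  positive, uniformly in \<open>\<theta>\<close>.\<close>

definition hyperbolic ::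
  "real \<Rightarrow> real set \<Rightarrow> real set \<Rightarrow> (nat \<Rightarrow> real) \<Rightarrow> (nat \<Rightarrow> real) \<Rightarrow> (nat \<Rightarrow> real) \<Rightarrow> (nat \<Rightarrow> real) \<Rightarrow> bool"
  where
  "hyperbolic T \<Theta>1 \<Theta>2 \<kappa> \<tau> \<rho> \<nu> \<longleftrightarrow>
     (\<exists>Cs>0. \<exists>c1>0. \<exists>c2>0.
        (\<forall>\<theta>\<in>\<Theta>1. (\<forall>k. 0 < eig \<kappa> \<tau> \<theta> k + Cs) \<and> incseq (\<lambda>k. eig \<kappa> \<tau> \<theta> k + Cs) \<and>
                 \<not> bdd_above (range (\<lambda>k. eig \<kappa> \<tau> \<theta> k + Cs))) \<and>
        (\<forall>k. \<forall>\<theta>\<in>\<Theta>1. \<forall>\<theta>'\<in>\<Theta>1.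
           c1 \<le> (eig \<kappa> \<tau> \<theta> k + Cs) / (eig \<kappa> \<tau> \<theta>' k + Cs) \<and>
           (eig \<kappa> \<tau> \<theta> k + Cs) / (eig \<kappa> \<tau> \<theta>' k + Cs) \<le> c2)) \<and>
     (\<exists>C>0. \<exists>J::nat. \<forall>k\<ge>J. \<forall>\<theta>1\<in>\<Theta>1. \<forall>\<theta>2\<in>\<Theta>2.
        0 < eig \<kappa> \<tau> \<theta>1 k \<and> T * eig \<rho> \<nu> \<theta>2 k \<le> ln (eig \<kappa> \<tau> \<theta>1 k) + C)"

section \<open>Stochastic basis and Brownian motions\<close>

text \<open>Only the values \<open>F t\<close> with \<open>t \<ge> 0\<close> are meaningful. The usual assumptions are completeness
  of \<open>M\<close>, all null sets in \<open>F 0\<close>, and right-continuity.\<close>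

definition stochastic_basis :: "'w measure \<Rightarrow> (real \<Rightarrow> 'w measure) \<Rightarrow> bool" where
  "stochastic_basis M F \<longleftrightarrow> prob_space M \<and> complete_measure M \<and>
     (\<forall>t\<ge>0. subalgebra M (F t)) \<and>
     (\<forall>s\<ge>0. \<forall>t\<ge>s. sets (F s) \<subseteq> sets (F t)) \<and>
     null_sets M \<subseteq> sets (F 0) \<and>
     (\<forall>t\<ge>0. sets (F t) = (\<Inter>s\<in>{t<..}. sets (F s)))"

definition brownian_motion ::
  "'w measure \<Rightarrow> (real \<Rightarrow> 'w measure) \<Rightarrow> (real \<Rightarrow> 'w \<Rightarrow> real) \<Rightarrow> bool" where
  "brownian_motion M F w \<longleftrightarrow>
     (\<forall>t\<ge>0. w t \<in> borel_measurable (F t)) \<and>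
     (AE \<omega> in M. w 0 \<omega> = 0) \<and>
     (AE \<omega> in M. continuous_on {0..} (\<lambda>t. w t \<omega>)) \<and>
     (\<forall>s\<ge>0. \<forall>t>s.
        distributed M lborel (\<lambda>\<omega>. w t \<omega> - w s \<omega>) (normal_density 0 (sqrt (t - s))) \<and>
        prob_space.indep_set M (sets (F s))
          (sets (vimage_algebra (space M) (\<lambda>\<omega>. w t \<omega> - w s \<omega>) borel)))"

text \<open>Independence of the processes: each \<open>w k\<close> is regarded as a random element of the product
  space of real functions on \<open>[0,\<infinity>)\<close>.\<close>

definition independent_brownian_motions ::
  "'w measure \<Rightarrow> (real \<Rightarrow> 'w measure) \<Rightarrow> (nat \<Rightarrow> real \<Rightarrow> 'w \<Rightarrow> real) \<Rightarrow> bool" where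
  "independent_brownian_motions M F w \<longleftrightarrow>
     (\<forall>k. brownian_motion M F (w k)) \<and>
     prob_space.indep_vars M (\<lambda>k. PiM {0..} (\<lambda>t. borel)) (\<lambda>k \<omega>. \<lambda>t\<in>{0..}. w k t \<omega>) UNIV"

section \<open>Solutions\<close>

definition adapted_on ::
  "real \<Rightarrow> (real \<Rightarrow> 'w measure) \<Rightarrow> (real \<Rightarrow> 'w \<Rightarrow> 'b::topological_space) \<Rightarrow> bool" where
  "adapted_on T F Y \<longleftrightarrow> (\<forall>t\<in>{0..T}. Y t \<in> borel_measurable (F t))"

text \<open>The equation \<open>u'' - m u' + l u = w'\<close>, \<open>u(0) = u'(0) = 0\<close>, in integrated form with \<open>v = u'\<close>.
  The noise is additive and \<open>w\<close> starts at \<open>0\<close>, so its stochastic integral over \<open>[0,t]\<close> is \<open>w t\<close>.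
  The initial conditions are the case \<open>t = 0\<close> of the two identities.\<close>

definition oscillator_solution ::
  "'w measure \<Rightarrow> (real \<Rightarrow> 'w measure) \<Rightarrow> real \<Rightarrow> real \<Rightarrow> real \<Rightarrow> (real \<Rightarrow> 'w \<Rightarrow> real) \<Rightarrow>
   (real \<Rightarrow> 'w \<Rightarrow> real) \<Rightarrow> (real \<Rightarrow> 'w \<Rightarrow> real) \<Rightarrow> bool" where
  "oscillator_solution M F T l m w u v \<longleftrightarrow>
     adapted_on T F u \<and> adapted_on T F v \<and>
     (AE \<omega> in M.
        set_integrable lborel {0..T} (\<lambda>s. u s \<omega>) \<and>
        set_integrable lborel {0..T} (\<lambda>s. v s \<omega>) \<and>
        (\<forall>t\<in>{0..T}.
           u t \<omega> = (LINT s:{0..t}|lborel. v s \<omega>) \<and>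
           v t \<omega> = (LINT s:{0..t}|lborel. - l * u s \<omega> + m * v s \<omega>) + w t \<omega>))"

text \<open>\<open>Y(t) = \<Sum>\<^sub>k y\<^sub>k(t) h\<^sub>k\<close> in mean square in the ambient space, for every \<open>t \<in> [0,T]\<close>, where \<open>e k\<close>
  is the image of \<open>h\<^sub>k\<close>. The nonnegative integral is used so that a non-integrable error
  counts as infinite.\<close>

definition mean_square_expansion ::
  "'w measure \<Rightarrow> real \<Rightarrow> (nat \<Rightarrow> 'x::real_normed_vector) \<Rightarrow> (real \<Rightarrow> 'w \<Rightarrow> 'x) \<Rightarrow>
   (nat \<Rightarrow> real \<Rightarrow> 'w \<Rightarrow> real) \<Rightarrow> bool" where
  "mean_square_expansion M T e Y y \<longleftrightarrow>
     (\<forall>t\<in>{0..T}.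
        (\<lambda>n. \<integral>\<^sup>+\<omega>. ennreal ((norm ((\<Sum>k<n. y k t \<omega> *\<^sub>R e k) - Y t \<omega>))\<^sup>2) \<partial>M) \<longlonglongrightarrow> 0)"

text \<open>\<open>U\<close> is an adapted process with values in the ambient space and coordinates \<open>u k\<close>; \<open>v k\<close> is
  the velocity of \<open>u k\<close>.\<close>

definition generalized_solution ::
  "'w measure \<Rightarrow> (real \<Rightarrow> 'w measure) \<Rightarrow> real \<Rightarrow> (nat \<Rightarrow> 'x::real_normed_vector) \<Rightarrow>
   (nat \<Rightarrow> real) \<Rightarrow> (nat \<Rightarrow> real) \<Rightarrow> (nat \<Rightarrow> real \<Rightarrow> 'w \<Rightarrow> real) \<Rightarrow>
   (real \<Rightarrow> 'w \<Rightarrow> 'x) \<Rightarrow> (nat \<Rightarrow> real \<Rightarrow> 'w \<Rightarrow> real) \<Rightarrow> (nat \<Rightarrow> real \<Rightarrow> 'w \<Rightarrow> real) \<Rightarrow> bool" where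
  "generalized_solution M F T e l m w U u v \<longleftrightarrow>
     adapted_on T F U \<and>
     (\<forall>k. oscillator_solution M F T (l k) (m k) (w k) (u k) (v k)) \<and>
     mean_square_expansion M T e U u"

end

theory Submission
  imports Defs "HOL-Real_Asymp.Real_Asymp"
begin

text \<open>The coordinates decouple: each \<open>u\<^sub>k\<close> solves a scalar damped oscillator equation driven by its own
  Brownian motion, and everything depends on a bound for \<open>E u\<^sub>k(t)\<^sup>2\<close> that is uniform in \<open>k\<close>.

  Let \<open>f\<^sub>k\<close> be the impulse response of the \<open>k\<close>-th oscillator. Along almost every path the equation is
  an ordinary linear system with a continuous forcing term, and variation of constants together with
  integration by parts gives \<open>u\<^sub>k(t)\<close> and \<open>v\<^sub>k(t)\<close> as limits of the Stieltjes sums of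
  \<open>\<integral> f\<^sub>k(t - s) dw\<^sub>k(s)\<close> and \<open>\<integral> f\<^sub>k'(t - s) dw\<^sub>k(s)\<close> (\<open>driven_oscillator_path\<close>). The sums are
  adapted, hence so are their limits.

  Brownian increments over disjoint intervals, or of different Brownian motions, are orthogonal. Hence,
  with \<open>e\<^sub>k\<close> the image of \<open>h\<^sub>k\<close>, the second moment of a finite linear combination of such sums with
  vector coefficients \<open>e\<^sub>k\<close> is at most \<open>B t \<Sum> \<parallel>e\<^sub>k\<parallel>\<^sup>2\<close>, where \<open>B\<close> bounds the squared kernels on \<open>[0,T]\<close>, and
  Fatou's lemma extends this to the limits (\<open>stochastic_integral_sum_second_moment\<close>). Since
  \<open>\<Sum> \<parallel>e\<^sub>k\<parallel>\<^sup>2\<close> converges, the partial sums of the expansion are Cauchy in mean square, and completeness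
  produces an adapted limit (\<open>mean_square_expansion_exists\<close>).

  It remains to bound the kernels uniformly in \<open>k\<close>. If \<open>\<mu>\<^sub>k \<le> 0\<close>, energy decay gives \<open>\<lambda>\<^sub>k f\<^sub>k\<^sup>2 \<le> 1\<close>.
  If \<open>\<mu>\<^sub>k > 0\<close>, then \<open>(\<lambda>\<^sub>k - \<mu>\<^sub>k\<^sup>2/4) f\<^sub>k(t)\<^sup>2 \<le> exp (\<mu>\<^sub>k t)\<close>, and hyperbolicity says exactly that
  \<open>exp (\<mu>\<^sub>k T)\<close> is at most a constant times \<open>\<lambda>\<^sub>k\<close> (\<open>hyperbolic_kernel_bound\<close>). If the \<open>\<mu>\<^sub>k\<close> are bounded
  above, the energy estimate also bounds the velocity kernels \<open>f\<^sub>k'\<close> (\<open>kernel_derivatives_bounded\<close>), so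
  the same expansion lemma applies to \<open>v\<close>.

  Uniqueness follows from pathwise uniqueness of the scalar equations (\<open>homogeneous_oscillator_unique\<close>)
  and uniqueness of mean-square limits.\<close>

section \<open>The fundamental solution of the damped oscillator\<close>

text \<open>The impulse response \<open>f\<close> of \<open>u'' - m u' + l u = 0\<close>. Its derivative is a separate argument
  because \<open>f\<close> is the kernel of the displacement and \<open>f'\<close> that of the velocity.\<close>

definition oscillator_kernel :: "real \<Rightarrow> real \<Rightarrow> (real \<Rightarrow> real) \<Rightarrow> (real \<Rightarrow> real) \<Rightarrow> bool" where
  "oscillator_kernel l m f f' \<longleftrightarrow> f 0 = 0 \<and> f' 0 = 1 \<and>
     (\<forall>t. (f has_real_derivative f' t) (at t)) \<and>
     (\<forall>t. (f' has_real_derivative m * f' t - l * f t) (at t))"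

lemma undamped_kernel_exists: "\<exists>g g'. oscillator_kernel d 0 g g'"
proof -
  consider "d = 0" | a where "a > 0" "d = a\<^sup>2" | a where "a > 0" "d = - a\<^sup>2"
  proof (cases d "0::real" rule: linorder_cases)
    case less
    then show ?thesis using that(3)[of "sqrt (- d)"] by simp
  next
    case greater
    then show ?thesis using that(2)[of "sqrt d"] by simp
  qed (use that in auto)
  then show ?thesis
  proof cases
    case 1
    then show ?thesis
      by (intro exI[of _ "\<lambda>t. t"] exI[of _ "\<lambda>_. 1"])
        (auto simp: oscillator_kernel_def intro!: derivative_eq_intros)
  next
    case 2
    then show ?thesis
      by (intro exI[of _ "\<lambda>t. sin (a * t) / a"] exI[of _ "\<lambda>t. cos (a * t)"])
        (auto simp: oscillator_kernel_def power2_eq_square intro!: derivative_eq_intros)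
  next
    case 3
    then show ?thesis
      by (intro exI[of _ "\<lambda>t. sinh (a * t) / a"] exI[of _ "\<lambda>t. cosh (a * t)"])
        (auto simp: oscillator_kernel_def power2_eq_square intro!: derivative_eq_intros)
  qed
qed

text \<open>The factor \<open>exp (m t / 2)\<close> removes the damping term and turns the stiffness \<open>l\<close> into
  \<open>l - m\<^sup>2 / 4\<close>.\<close>

lemma oscillator_kernel_exists: "\<exists>f f'. oscillator_kernel l m f f'"
proof -
  obtain g g' where g: "oscillator_kernel (l - m\<^sup>2 / 4) 0 g g'"
    using undamped_kernel_exists by blast
  then have d: "(g has_real_derivative g' t) (at t)"
    "(g' has_real_derivative (m\<^sup>2 / 4 - l) * g t) (at t)" for t
    by (auto simp: oscillator_kernel_def algebra_simps)
  have init: "g 0 = 0" "g' 0 = 1"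
    using g by (auto simp: oscillator_kernel_def)
  show ?thesis
    by (intro exI[of _ "\<lambda>t. exp (m * t / 2) * g t"]
        exI[of _ "\<lambda>t. exp (m * t / 2) * (g' t + m / 2 * g t)"])
      (auto simp: oscillator_kernel_def field_simps power2_eq_square init
        intro!: derivative_eq_intros d)
qed

lemma oscillator_kernel_deriv:
  assumes "oscillator_kernel l m f f'" "(g has_real_derivative g') (at t within S)"
  shows "((\<lambda>s. f (g s)) has_real_derivative f' (g t) * g') (at t within S)"
    and "((\<lambda>s. f' (g s)) has_real_derivative (m * f' (g t) - l * f (g t)) * g') (at t within S)"
  using assms by (auto simp: oscillator_kernel_def intro: DERIV_chain2)

text \<open>The flow of an autonomous linear system is a group, so each entry of its matrix at time
  \<open>r + q\<close> is bilinear in the entries at \<open>r\<close> and \<open>q\<close>. With \<open>r + q = c\<close> fixed, the right-hand sides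
  have derivative zero in \<open>r\<close>, hence equal their values at \<open>r = 0\<close>. These formulas separate the
  variables in convolutions with the kernel, so that such convolutions can be differentiated by the
  product rule.\<close>

lemma oscillator_kernel_add:
  assumes "oscillator_kernel l m f f'"
  shows "f (r + q) = f r * f' q + f' r * f q - m * f r * f q"
    and "f' (r + q) = f' r * f' q - l * f r * f q"
proof -
  note d = oscillator_kernel_deriv[OF assms]
  define c where "c = r + q"
  have "((\<lambda>r. f r * f' (c - r) + f' r * f (c - r) - m * f r * f (c - r)) has_real_derivative 0) (at x)"
    for x by (auto intro!: derivative_eq_intros d simp: algebra_simps)
  from DERIV_isconst_all[OF allI[OF this], of r 0]
  show "f (r + q) = f r * f' q + f' r * f q - m * f r * f q"
    using assms by (simp add: c_def oscillator_kernel_def)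
  have "((\<lambda>r. f' r * f' (c - r) - l * f r * f (c - r)) has_real_derivative 0) (at x)"
    for x by (auto intro!: derivative_eq_intros d simp: algebra_simps)
  from DERIV_isconst_all[OF allI[OF this], of r 0]
  show "f' (r + q) = f' r * f' q - l * f r * f q"
    using assms by (simp add: c_def oscillator_kernel_def)
qed

lemma oscillator_kernel_continuous:
  assumes "oscillator_kernel l m f f'" "continuous_on S g"
  shows "continuous_on S (\<lambda>s. f (g s))" "continuous_on S (\<lambda>s. f' (g s))"
proof -
  have "continuous_on UNIV f" "continuous_on UNIV f'"
    using assms(1) by (auto simp: oscillator_kernel_def intro!: DERIV_continuous_on)
  then show "continuous_on S (\<lambda>s. f (g s))" "continuous_on S (\<lambda>s. f' (g s))"
    using assms(2) by (auto intro: continuous_on_compose2)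
qed

text \<open>The energy \<open>f'\<^sup>2 + l f\<^sup>2\<close> has derivative \<open>2 m f'\<^sup>2\<close>, hence grows at most at the rate \<open>2 c\<close>. This
  controls the velocity kernel, and the displacement kernel when \<open>m \<le> 0\<close>; for large positive \<open>m\<close> it
  loses a factor of size \<open>exp (m t)\<close> and the next identity takes its place.\<close>

lemma oscillator_kernel_energy_le:
  assumes "oscillator_kernel l m f f'" "0 \<le> l" "m \<le> c" "0 \<le> c" "0 \<le> t"
  shows "(f' t)\<^sup>2 + l * (f t)\<^sup>2 \<le> exp (2 * c * t)"
proof -
  note d = oscillator_kernel_deriv[OF assms(1)]
  let ?E = "\<lambda>t. exp (- (2 * c * t)) * ((f' t)\<^sup>2 + l * (f t)\<^sup>2)"
  let ?D = "\<lambda>t. exp (- (2 * c * t)) * (2 * ((m - c) * (f' t)\<^sup>2) - 2 * (c * l * (f t)\<^sup>2))"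
  have D: "(?E has_real_derivative ?D x) (at x)" for x
    by (auto intro!: derivative_eq_intros d simp: algebra_simps power2_eq_square)
  have neg: "?D x \<le> 0" for x
  proof -
    have "(m - c) * (f' x)\<^sup>2 \<le> 0" "0 \<le> c * l * (f x)\<^sup>2"
      using assms by (auto intro: mult_nonpos_nonneg)
    then show ?thesis
      by (intro mult_nonneg_nonpos) (simp, linarith)
  qed
  have "?E t \<le> ?E 0"
    using D neg \<open>0 \<le> t\<close> by (metis (no_types, lifting) DERIV_nonpos_imp_nonincreasing[of 0 t ?E])
  then show ?thesis
    using assms(1) by (simp add: oscillator_kernel_def exp_minus field_simps)
qed

text \<open>Conservation of energy for \<open>exp (- m t / 2) * f t\<close>, which solves an undamped equation.\<close>

lemma oscillator_kernel_damped_energy: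
  assumes "oscillator_kernel l m f f'"
  shows "(f' t - m / 2 * f t)\<^sup>2 + (l - m\<^sup>2 / 4) * (f t)\<^sup>2 = exp (m * t)"
proof -
  note d = oscillator_kernel_deriv[OF assms]
  have "((\<lambda>t. exp (- (m * t)) * ((f' t - m / 2 * f t)\<^sup>2 + (l - m\<^sup>2 / 4) * (f t)\<^sup>2))
      has_real_derivative 0) (at x)" for x
    by (auto intro!: derivative_eq_intros d simp: field_simps power2_eq_square)
  from DERIV_isconst_all[OF allI[OF this], of t 0] show ?thesis
    using assms by (simp add: oscillator_kernel_def exp_minus field_simps)
qed

section \<open>The driven oscillator along one path\<close>

text \<open>The integrator is evaluated on the uniform partition of \<open>[0,t]\<close>, the kernel \<open>g (t - s)\<close> at the
  left end points, so the sum is an elementary Wiener integral. The sum for \<open>n = 0\<close> is empty.\<close>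

definition stieltjes_sum :: "(real \<Rightarrow> real) \<Rightarrow> (real \<Rightarrow> real) \<Rightarrow> real \<Rightarrow> nat \<Rightarrow> real" where
  "stieltjes_sum g x t n =
     (\<Sum>i<n. g (t - t * real i / real n) * (x (t * real (Suc i) / real n) - x (t * real i / real n)))"

text \<open>Integration by parts: \<open>\<integral> g (t - s) dx(s) = g 0 x(t) - g t x(0) + \<integral> g' (t - s) x(s) ds\<close>, where the last
  integral is represented by any antiderivative \<open>H\<close> of its integrand. The right-hand
  side makes sense for every continuous \<open>x\<close>. On each cell the error of the summation by parts is estimated by the mean value
  inequality, and uniform continuity of \<open>x\<close> makes the total error small.\<close>

lemma stieltjes_sum_tendsto:
  fixes g g' x H :: "real \<Rightarrow> real"
  assumes "0 \<le> t"
    and g: "\<And>s. (g has_real_derivative g' s) (at s)" and "continuous_on {0..t} g'"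
    and x: "continuous_on {0..t} x"
    and H: "\<And>s. s \<in> {0..t} \<Longrightarrow> (H has_real_derivative g' (t - s) * x s) (at s within {0..t})"
  shows "stieltjes_sum g x t \<longlonglongrightarrow> g 0 * x t - g t * x 0 + (H t - H 0)"
proof (rule LIMSEQ_I)
  fix r :: real
  assume "0 < r"
  obtain K where K: "0 < K" "\<And>s. s \<in> {0..t} \<Longrightarrow> \<bar>g' s\<bar> \<le> K"
    using compact_continuous_image[OF \<open>continuous_on {0..t} g'\<close> compact_Icc, THEN compact_imp_bounded]
    unfolding bounded_pos by auto
  \<comment> \<open>oscillation of \<open>x\<close> allowed per cell; the total error is then at most \<open>K e t < r\<close>\<close>
  define e where "e = r / (2 * K * (t + 1))"
  have "0 < e"
    using \<open>0 < r\<close> K \<open>0 \<le> t\<close> by (simp add: e_def)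
  then obtain d where d: "0 < d"
    "\<And>s s'. s \<in> {0..t} \<Longrightarrow> s' \<in> {0..t} \<Longrightarrow> \<bar>s' - s\<bar> < d \<Longrightarrow> \<bar>x s' - x s\<bar> < e"
    using compact_uniformly_continuous[OF x compact_Icc]
    unfolding uniformly_continuous_on_def dist_real_def by meson
  obtain N where N: "t / d < real N"
    using reals_Archimedean2 by blast
  show "\<exists>no. \<forall>n\<ge>no. norm (stieltjes_sum g x t n - (g 0 * x t - g t * x 0 + (H t - H 0))) < r"
  proof (intro exI allI impI)
    fix n
    assume n: "max 1 N \<le> n"
    then have "0 < n" "t / d < real n"
      using N by auto
    define p where "p i = t * real i / real n" for i
    have p0: "p 0 = 0" and pn: "p n = t"
      using \<open>0 < n\<close> by (auto simp: p_def)
    have step: "p (Suc i) - p i = t / n" for i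
      by (simp add: p_def field_simps add_divide_distrib)
    have small: "t / n < d"
      using \<open>t / d < real n\<close> \<open>0 < d\<close> \<open>0 < n\<close> by (simp add: field_simps)
    have p_in: "p i \<in> {0..t}" if "i \<le> n" for i
      using that \<open>0 < n\<close> \<open>0 \<le> t\<close> mult_left_mono[of "real i" "real n" t]
      by (simp add: p_def pos_divide_le_eq)
    \<comment> \<open>the error of the summation by parts on one cell\<close>
    define D where "D i = (g (t - p i) - g (t - p (Suc i))) * x (p (Suc i)) - (H (p (Suc i)) - H (p i))" for i
    have cell: "\<bar>D i\<bar> \<le> K * e * (t / n)" if "i < n" for i
    proof -
      let ?b = "p (Suc i)"
      let ?S = "{p i..?b}"
      have sub: "?S \<subseteq> {0..t}"
        using p_in[of i] p_in[of "Suc i"] that by auto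
      have le: "p i \<le> ?b"
      proof -
        have "0 \<le> t / n"
          using \<open>0 \<le> t\<close> by simp
        then show ?thesis
          using step[of i] by linarith
      qed
      \<comment> \<open>its increment over the cell is \<open>- D i\<close>, its derivative is small\<close>
      define \<phi> where "\<phi> s = H s + g (t - s) * x ?b" for s
      have "(\<phi> has_real_derivative g' (t - s) * (x s - x ?b)) (at s within ?S)" if "s \<in> ?S" for s
      proof -
        have "(H has_real_derivative g' (t - s) * x s) (at s within ?S)"
          using DERIV_subset[OF H sub] sub that by blast
        moreover have "((\<lambda>s. g (t - s)) has_real_derivative g' (t - s) * (- 1)) (at s within ?S)"
          by (rule DERIV_chain2[OF g]) (auto intro!: derivative_eq_intros)
        ultimately show ?thesis
          unfolding \<phi>_def
          by (rule DERIV_add[OF _ DERIV_cmult_right, THEN DERIV_cong]) (simp add: algebra_simps)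
      qed
      moreover have "norm (g' (t - s) * (x s - x ?b)) \<le> K * e" if s: "s \<in> ?S" for s
      proof -
        have "\<bar>x s - x ?b\<bar> < e"
          using s sub step[of i] small by (intro d(2)) auto
        moreover have "\<bar>g' (t - s)\<bar> \<le> K"
          using s sub by (intro K(2)) auto
        ultimately show ?thesis
          using K(1) by (simp add: abs_mult mult_mono)
      qed
      ultimately have "norm (\<phi> ?b - \<phi> (p i)) \<le> K * e * norm (?b - p i)"
        using le by (intro field_differentiable_bound[of ?S]) auto
      moreover have "\<phi> ?b - \<phi> (p i) = - D i"
        by (simp add: \<phi>_def D_def left_diff_distrib)
      ultimately show ?thesis
        using \<open>0 \<le> t\<close> by (simp add: step)
    qed
    have "stieltjes_sum g x t n = (\<Sum>i<n. D i +
        ((g (t - p (Suc i)) * x (p (Suc i)) - g (t - p i) * x (p i)) + (H (p (Suc i)) - H (p i))))"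
      unfolding stieltjes_sum_def p_def[symmetric] D_def
      by (intro sum.cong refl) (simp add: left_diff_distrib right_diff_distrib)
    also have "\<dots> = (\<Sum>i<n. D i) + (g 0 * x t - g t * x 0 + (H t - H 0))"
      using sum_lessThan_telescope[of "\<lambda>i. g (t - p i) * x (p i)" n]
        sum_lessThan_telescope[of "\<lambda>i. H (p i)" n]
      by (simp only: sum.distrib) (simp add: p0 pn)
    finally have "norm (stieltjes_sum g x t n - (g 0 * x t - g t * x 0 + (H t - H 0))) \<le> (\<Sum>i<n. \<bar>D i\<bar>)"
      by (simp add: sum_abs)
    also have "\<dots> \<le> (\<Sum>i<n. K * e * (t / n))"
      by (intro sum_mono cell) auto
    also have "\<dots> = r * (t / (2 * (t + 1)))"
      using \<open>0 < n\<close> K by (simp add: e_def)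
    also have "\<dots> < r * 1"
      using \<open>0 < r\<close> \<open>0 \<le> t\<close> by (intro mult_strict_left_mono) (auto simp: field_simps)
    also have "r * 1 = r"
      by simp
    finally show "norm (stieltjes_sum g x t n - (g 0 * x t - g t * x 0 + (H t - H 0))) < r" .
  qed
qed

lemma set_lebesgue_integral_of_derivative:
  fixes V v :: "real \<Rightarrow> real"
  assumes "0 \<le> t" "t \<le> T" "continuous_on {0..T} v"
    and V: "\<And>s. s \<in> {0..T} \<Longrightarrow> (V has_real_derivative v s) (at s within {0..T})"
  shows "(LINT s:{0..t}|lborel. v s) = V t - V 0"
proof -
  have "continuous_on {0..t} v"
    using assms by (auto intro: continuous_on_subset)
  then have eq: "(LINT s:{0..t}|lborel. v s) = integral {0..t} v"
    by (intro set_borel_integral_eq_integral borel_integrable_atLeastAtMost')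
  have "(v has_integral V t - V 0) {0..t}"
  proof (rule fundamental_theorem_of_calculus)
    show "(V has_vector_derivative v s) (at s within {0..t})" if "s \<in> {0..t}" for s
    proof -
      have "(V has_real_derivative v s) (at s within {0..t})"
        using that assms(2) by (intro DERIV_subset[OF V]) auto
      then show ?thesis
        by (simp add: has_real_derivative_iff_has_vector_derivative)
    qed
  qed fact
  then show ?thesis
    unfolding eq by (rule integral_unique)
qed

text \<open>Subtracting the noise from the velocity, \<open>z = v - x\<close>, leaves an ordinary differential equation
  \<open>u' = z + x\<close>, \<open>z' = - l u + m (z + x)\<close>, which makes sense for a path that is merely continuous. By the
  addition formulas, variation of constants gives \<open>u\<close> and \<open>z\<close> as combinations of the two integrals
  \<open>P\<close> and \<open>Q\<close>. Integration by parts then identifies \<open>u\<close> and \<open>v\<close> as limits of Stieltjes sums with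
  kernels \<open>f\<close> and \<open>f'\<close>; this is the form in which second moments can be computed.\<close>

lemma driven_oscillator_path:
  fixes x :: "real \<Rightarrow> real"
  assumes ker: "oscillator_kernel l m f f'" and x: "continuous_on {0..T} x" and x0: "x 0 = 0"
  shows "\<exists>u v. continuous_on {0..T} u \<and> continuous_on {0..T} v \<and>
     (\<forall>t\<in>{0..T}. stieltjes_sum f x t \<longlonglongrightarrow> u t \<and> stieltjes_sum f' x t \<longlonglongrightarrow> v t \<and>
        u t = (LINT s:{0..t}|lborel. v s) \<and>
        v t = (LINT s:{0..t}|lborel. - l * u s + m * v s) + x t)"
proof -
  note d = oscillator_kernel_deriv[OF ker]
  note add = oscillator_kernel_add[OF ker]
  note cont = oscillator_kernel_continuous[OF ker]
  have init: "f 0 = 0" "f' 0 = 1"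
    using ker by (auto simp: oscillator_kernel_def)
  define P where "P t = integral {0..t} (\<lambda>s. f (- s) * x s)" for t
  define Q where "Q t = integral {0..t} (\<lambda>s. f' (- s) * x s)" for t
  have P: "(P has_real_derivative f (- s) * x s) (at s within {0..T})"
    and Q: "(Q has_real_derivative f' (- s) * x s) (at s within {0..T})"
    if "s \<in> {0..T}" for s
    unfolding atomize_conj P_def Q_def using that
    by (auto intro!: integral_has_real_derivative continuous_intros cont x)
  define u where "u t = f' t * Q t - l * f t * P t" for t
  define z where "z t = (m * f' t - l * f t) * Q t - l * f' t * P t" for t
  define v where "v t = x t + z t" for t
  have w1: "f' s * f' (- s) - l * f s * f (- s) = 1" and w2: "f s * f' (- s) + f' s * f (- s) - m * f s * f (- s) = 0" for s
    using add(2)[of s "- s"] add(1)[of s "- s"] init by simp_all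
  note dd = P Q d(1)[OF DERIV_ident] d(2)[OF DERIV_ident]
  have u: "(u has_real_derivative v s) (at s within {0..T})" if "s \<in> {0..T}" for s
  proof -
    have "(u has_real_derivative x s * (f' s * f' (- s) - l * f s * f (- s)) + z s) (at s within {0..T})"
      unfolding u_def z_def using that
      by (auto intro!: derivative_eq_intros dd simp: algebra_simps)
    then show ?thesis
      by (simp add: w1 v_def)
  qed
  have z: "(z has_real_derivative - l * u s + m * v s) (at s within {0..T})" if "s \<in> {0..T}" for s
  proof -
    have "(z has_real_derivative m * z s - l * u s + x s * (m * (f' s * f' (- s) - l * f s * f (- s))
        - l * (f s * f' (- s) + f' s * f (- s) - m * f s * f (- s)))) (at s within {0..T})"
      unfolding u_def z_def using that
      by (auto intro!: derivative_eq_intros dd simp: algebra_simps)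
    then show ?thesis
      unfolding w1 w2 by (simp add: v_def algebra_simps)
  qed
  have cu: "continuous_on {0..T} u" and cz: "continuous_on {0..T} z"
    by (auto intro!: DERIV_continuous_on u z)
  then have cv: "continuous_on {0..T} v"
    using x by (auto simp: v_def intro!: continuous_intros)
  have init': "u 0 = 0" "z 0 = 0"
    by (auto simp: u_def z_def P_def Q_def)
  show ?thesis
  proof (rule exI[of _ u], rule exI[of _ v], intro conjI ballI cu cv)
    fix t
    assume t: "t \<in> {0..T}"
    show "u t = (LINT s:{0..t}|lborel. v s)"
      using set_lebesgue_integral_of_derivative[of t T v u] t cv u by (simp add: init')
    have "(LINT s:{0..t}|lborel. - l * u s + m * v s) = z t"
      using set_lebesgue_integral_of_derivative[of t T "\<lambda>s. - l * u s + m * v s" z] t cv cu z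
      by (simp add: init' continuous_intros)
    then show "v t = (LINT s:{0..t}|lborel. - l * u s + m * v s) + x t"
      by (simp add: v_def)
    have sub: "{0..t} \<subseteq> {0..T}" and "0 \<le> t"
      using t by auto
    have xt: "continuous_on {0..t} x"
      using x sub continuous_on_subset by blast
    have PQ: "(P has_real_derivative f (- s) * x s) (at s within {0..t})"
      "(Q has_real_derivative f' (- s) * x s) (at s within {0..t})" if "s \<in> {0..t}" for s
      using DERIV_subset[OF P sub] DERIV_subset[OF Q sub] sub that by blast+
    \<comment> \<open>by the addition formulas, the integrals over the convolution kernels have separated variables\<close>
    define H1 where "H1 s = f' t * Q s - l * f t * P s" for s
    define H2 where "H2 s = (m * f' t - l * f t) * Q s - l * f' t * P s" for s
    have "(H1 has_real_derivative f' (t - s) * x s) (at s within {0..t})" if "s \<in> {0..t}" for s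
    proof -
      have "(H1 has_real_derivative (f' t * f' (- s) - l * f t * f (- s)) * x s) (at s within {0..t})"
        unfolding H1_def using that by (auto intro!: derivative_eq_intros PQ simp: algebra_simps)
      then show ?thesis
        using add(2)[of t "- s"] by simp
    qed
    then have "stieltjes_sum f x t \<longlonglongrightarrow> f 0 * x t - f t * x 0 + (H1 t - H1 0)"
      using d(1)[OF DERIV_ident]
      by (intro stieltjes_sum_tendsto[where g' = f'] \<open>0 \<le> t\<close> xt cont) (auto intro: continuous_intros)
    then show "stieltjes_sum f x t \<longlonglongrightarrow> u t"
      by (simp add: init x0 H1_def u_def P_def Q_def)
    have "(H2 has_real_derivative (m * f' (t - s) - l * f (t - s)) * x s) (at s within {0..t})"
      if "s \<in> {0..t}" for s
    proof -
      have "(H2 has_real_derivative (m * (f' t * f' (- s) - l * f t * f (- s))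
          - l * (f t * f' (- s) + f' t * f (- s) - m * f t * f (- s))) * x s) (at s within {0..t})"
        unfolding H2_def using that by (auto intro!: derivative_eq_intros PQ simp: algebra_simps)
      then show ?thesis
        using add(2)[of t "- s"] add(1)[of t "- s"] by simp
    qed
    then have "stieltjes_sum f' x t \<longlonglongrightarrow> f' 0 * x t - f' t * x 0 + (H2 t - H2 0)"
      using d(2)[OF DERIV_ident]
      by (intro stieltjes_sum_tendsto[where g' = "\<lambda>s. m * f' s - l * f s"] \<open>0 \<le> t\<close> xt)
        (auto intro!: continuous_intros cont)
    then show "stieltjes_sum f' x t \<longlonglongrightarrow> v t"
      by (simp add: init x0 H2_def v_def z_def P_def Q_def)
  qed
qed

lemma indefinite_integral_of_set_integrable:
  fixes v :: "real \<Rightarrow> real"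
  assumes "set_integrable lborel {0..T} v" "t \<in> {0..T}"
  shows "(LINT s:{0..t}|lborel. v s) = integral {0..t} v"
  using assms by (intro set_borel_integral_eq_integral set_integrable_subset[OF assms(1)]) auto

text \<open>Solutions are only required to be integrable; continuity comes from the integral equation.\<close>

lemma integral_equation_continuous:
  fixes u v :: "real \<Rightarrow> real"
  assumes "set_integrable lborel {0..T} v" "\<And>t. t \<in> {0..T} \<Longrightarrow> u t = (LINT s:{0..t}|lborel. v s)"
  shows "continuous_on {0..T} u"
proof -
  have "v integrable_on {0..T}"
    using assms(1) by (rule set_borel_integral_eq_integral)
  then have "continuous_on {0..T} (\<lambda>t. integral {0..t} v)"
    by (rule indefinite_integral_continuous_1)
  moreover have "u t = integral {0..t} v" if "t \<in> {0..T}" for t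
    using assms(2)[OF that] indefinite_integral_of_set_integrable[OF assms(1) that] by simp
  ultimately show ?thesis
    using continuous_on_cong[of "{0..T}" "{0..T}" u "\<lambda>t. integral {0..t} v"] by blast
qed

lemma integral_equation_derivative:
  fixes u v :: "real \<Rightarrow> real"
  assumes "continuous_on {0..T} v" "\<And>t. t \<in> {0..T} \<Longrightarrow> u t = (LINT s:{0..t}|lborel. v s)"
    and "t \<in> {0..T}"
  shows "(u has_real_derivative v t) (at t within {0..T})"
proof -
  have "((\<lambda>t. integral {0..t} v) has_real_derivative v t) (at t within {0..T})"
    using assms(1,3) by (intro integral_has_real_derivative)
  moreover have "u s = integral {0..s} v" if "s \<in> {0..T}" for s
    using assms(2)[OF that] that
      indefinite_integral_of_set_integrable[OF borel_integrable_atLeastAtMost'[OF assms(1)] that]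
    by simp
  ultimately show ?thesis
    using assms(3)
    by (intro has_field_derivative_transform_within[of "\<lambda>t. integral {0..t} v" _ _ _ 1 u]) auto
qed

text \<open>Gronwall's argument: for \<open>K\<close> large, \<open>exp (- K t) * (a\<^sup>2 + b\<^sup>2)\<close> is nonincreasing, nonnegative
  and zero at \<open>t = 0\<close>.\<close>

lemma homogeneous_oscillator_unique:
  fixes a b :: "real \<Rightarrow> real"
  assumes "set_integrable lborel {0..T} a" "set_integrable lborel {0..T} b"
    and a: "\<And>t. t \<in> {0..T} \<Longrightarrow> a t = (LINT s:{0..t}|lborel. b s)"
    and b: "\<And>t. t \<in> {0..T} \<Longrightarrow> b t = (LINT s:{0..t}|lborel. - l * a s + m * b s)"
    and "t \<in> {0..T}"
  shows "a t = 0 \<and> b t = 0"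
proof -
  have ca: "continuous_on {0..T} a"
    by (rule integral_equation_continuous[OF assms(2) a])
  have int: "set_integrable lborel {0..T} (\<lambda>s. - l * a s + m * b s)"
    by (rule set_integral_add(1)[OF set_integrable_mult_right set_integrable_mult_right])
      (rule assms)+
  have cb: "continuous_on {0..T} b"
    by (rule integral_equation_continuous[OF int b])
  have da: "(a has_real_derivative b t) (at t within {0..T})" if "t \<in> {0..T}" for t
    by (rule integral_equation_derivative[OF cb a that])
  have "continuous_on {0..T} (\<lambda>s. - l * a s + m * b s)"
    by (intro continuous_intros ca cb)
  then have db: "(b has_real_derivative - l * a t + m * b t) (at t within {0..T})" if "t \<in> {0..T}" for t
    using integral_equation_derivative[OF _ b that] by blast
  \<comment> \<open>dominates the quadratic form \<open>2 (1 - l) a b + 2 m b\<^sup>2\<close>, the derivative of \<open>a\<^sup>2 + b\<^sup>2\<close>\<close>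
  define K where "K = 1 + \<bar>l\<bar> + 2 * \<bar>m\<bar>"
  let ?E = "\<lambda>t. exp (- (K * t)) * ((a t)\<^sup>2 + (b t)\<^sup>2)"
  let ?D = "\<lambda>t. exp (- (K * t)) * (2 * (1 - l) * (a t * b t) + 2 * m * (b t)\<^sup>2 - K * ((a t)\<^sup>2 + (b t)\<^sup>2))"
  have D: "(?E has_real_derivative ?D x) (at x within {0..T})" if "x \<in> {0..T}" for x
    using that by (auto intro!: derivative_eq_intros da db simp: algebra_simps power2_eq_square)
  have neg: "?D x \<le> 0" for x
  proof -
    have "2 * \<bar>a x * b x\<bar> \<le> (a x)\<^sup>2 + (b x)\<^sup>2"
      using sum_squares_bound[of "\<bar>a x\<bar>" "\<bar>b x\<bar>"] by (simp add: abs_mult)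
    then have "(1 + \<bar>l\<bar>) * (2 * \<bar>a x * b x\<bar>) \<le> (1 + \<bar>l\<bar>) * ((a x)\<^sup>2 + (b x)\<^sup>2)"
      by (intro mult_left_mono) auto
    moreover have "2 * (1 - l) * (a x * b x) \<le> (1 + \<bar>l\<bar>) * (2 * \<bar>a x * b x\<bar>)"
    proof -
      have "2 * (1 - l) * (a x * b x) \<le> 2 * (\<bar>1 - l\<bar> * \<bar>a x * b x\<bar>)"
        using abs_ge_self[of "(1 - l) * (a x * b x)"]
        by (simp only: abs_mult mult.assoc mult_left_mono zero_le_numeral)
      also have "\<dots> \<le> 2 * ((1 + \<bar>l\<bar>) * \<bar>a x * b x\<bar>)"
        by (intro mult_left_mono mult_right_mono) auto
      finally show ?thesis by (simp add: mult_ac)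
    qed
    moreover have "m * (b x)\<^sup>2 \<le> \<bar>m\<bar> * ((a x)\<^sup>2 + (b x)\<^sup>2)"
      by (intro mult_mono) auto
    moreover have "K * ((a x)\<^sup>2 + (b x)\<^sup>2) =
        (1 + \<bar>l\<bar>) * ((a x)\<^sup>2 + (b x)\<^sup>2) + 2 * (\<bar>m\<bar> * ((a x)\<^sup>2 + (b x)\<^sup>2))"
      unfolding K_def by (simp only: distrib_right mult.assoc)
    ultimately have "2 * (1 - l) * (a x * b x) + 2 * (m * (b x)\<^sup>2) \<le> K * ((a x)\<^sup>2 + (b x)\<^sup>2)"
      by linarith
    then show ?thesis
      by (intro mult_nonneg_nonpos) (simp_all add: mult.assoc)
  qed
  have "?E t \<le> ?E 0"
  proof -
    have "continuous_on {0..t} ?E"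
      using \<open>t \<in> {0..T}\<close>
      by (auto intro!: continuous_intros continuous_on_subset[OF ca] continuous_on_subset[OF cb])
    moreover have "(?E has_real_derivative ?D x) (at x)" if "0 < x" "x < t" for x
    proof -
      have "x \<in> {0..T}" "at x within {0..T} = at x"
        using that \<open>t \<in> {0..T}\<close> by (auto intro!: at_within_interior)
      then show ?thesis
        using D[of x] by simp
    qed
    ultimately show ?thesis
      using neg \<open>t \<in> {0..T}\<close> DERIV_nonpos_imp_decreasing_open[of 0 t ?E] by (meson atLeastAtMost_iff)
  qed
  also have "?E 0 = 0"
  proof -
    have "a 0 = 0" "b 0 = 0"
      using a[of 0] b[of 0] \<open>t \<in> {0..T}\<close>
        indefinite_integral_of_set_integrable[OF assms(2), of 0]
        indefinite_integral_of_set_integrable[OF int, of 0]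
      by simp_all
    then show ?thesis
      by simp
  qed
  finally have "(a t)\<^sup>2 + (b t)\<^sup>2 \<le> 0"
    by (simp add: mult_le_0_iff)
  then show ?thesis
    by (metis sum_power2_le_zero_iff)
qed

section \<open>Orthogonality of Brownian increments\<close>

lemma stochastic_basisD:
  assumes "stochastic_basis M F"
  shows "prob_space M" "0 \<le> t \<Longrightarrow> subalgebra M (F t)"
    and "0 \<le> s \<Longrightarrow> s \<le> t \<Longrightarrow> g \<in> borel_measurable (F s) \<Longrightarrow> g \<in> borel_measurable (F t)"
    and "0 \<le> t \<Longrightarrow> g \<in> borel_measurable (F t) \<Longrightarrow> g \<in> borel_measurable M"
proof -
  have sub: "\<forall>t\<ge>0. subalgebra M (F t)" and mono: "\<forall>s\<ge>0. \<forall>t\<ge>s. sets (F s) \<subseteq> sets (F t)"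
    and P: "prob_space M"
    using assms unfolding stochastic_basis_def atomize_conj by (elim conjE) (intro conjI)
  show "prob_space M"
    by (rule P)
  show "subalgebra M (F t)" if "0 \<le> t"
    using sub that by blast
  show "g \<in> borel_measurable (F t)" if "0 \<le> s" "s \<le> t" "g \<in> borel_measurable (F s)"
  proof (rule measurable_from_subalg[OF _ that(3)])
    have "subalgebra M (F s)" "subalgebra M (F t)" "sets (F s) \<subseteq> sets (F t)"
      using sub mono that by auto
    then show "subalgebra (F t) (F s)"
      by (simp add: subalgebra_def)
  qed
  show "g \<in> borel_measurable M" if "0 \<le> t" "g \<in> borel_measurable (F t)"
    using measurable_from_subalg[OF _ that(2)] sub that(1) by blast
qed

lemma brownian_motion_measurable:
  assumes "stochastic_basis M F" "brownian_motion M F w" "0 \<le> s"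
  shows "s \<le> t \<Longrightarrow> w s \<in> borel_measurable (F t)" and "w s \<in> borel_measurable M"
proof -
  have "w s \<in> borel_measurable (F s)"
    using assms by (simp add: brownian_motion_def)
  then show "s \<le> t \<Longrightarrow> w s \<in> borel_measurable (F t)" "w s \<in> borel_measurable M"
    using stochastic_basisD(3,4)[OF assms(1)] \<open>0 \<le> s\<close> by blast+
qed

lemma brownian_increment_moments:
  assumes basis: "stochastic_basis M F" and w: "brownian_motion M F w" and "0 \<le> s" "s \<le> t"
  shows "integrable M (\<lambda>\<omega>. w t \<omega> - w s \<omega>)" "(\<integral>\<omega>. w t \<omega> - w s \<omega> \<partial>M) = 0"
    and "integrable M (\<lambda>\<omega>. (w t \<omega> - w s \<omega>)\<^sup>2)" "(\<integral>\<omega>. (w t \<omega> - w s \<omega>)\<^sup>2 \<partial>M) = t - s"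
proof -
  interpret prob_space M
    using basis by (rule stochastic_basisD)
  have "integrable M (\<lambda>\<omega>. w t \<omega> - w s \<omega>) \<and> expectation (\<lambda>\<omega>. w t \<omega> - w s \<omega>) = 0 \<and>
    integrable M (\<lambda>\<omega>. (w t \<omega> - w s \<omega>)\<^sup>2) \<and> expectation (\<lambda>\<omega>. (w t \<omega> - w s \<omega>)\<^sup>2) = t - s"
  proof (cases "s = t")
    case False
    let ?\<sigma> = "sqrt (t - s)"
    have \<sigma>: "0 < ?\<sigma>"
      using False \<open>s \<le> t\<close> by simp
    have D: "distributed M lborel (\<lambda>\<omega>. w t \<omega> - w s \<omega>) (normal_density 0 ?\<sigma>)"
      using w \<open>0 \<le> s\<close> \<open>s \<le> t\<close> False by (simp add: brownian_motion_def)
    have pow: "integrable M (\<lambda>\<omega>. (w t \<omega> - w s \<omega>) ^ k)" for k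
      using distributed_integrable[OF D, of "\<lambda>x. x ^ k"] integrable_normal_moment[OF \<sigma>, of 0 k]
      by simp
    have "expectation (\<lambda>\<omega>. w t \<omega> - w s \<omega>) = 0"
      using normal_distributed_expectation[OF \<sigma> D] .
    moreover have "expectation (\<lambda>\<omega>. (w t \<omega> - w s \<omega>)\<^sup>2) = t - s"
      using normal_distributed_variance[OF \<sigma> D] calculation \<open>s \<le> t\<close> by simp
    ultimately show ?thesis
      using pow[of 1] pow[of 2] by simp
  qed simp
  then show "integrable M (\<lambda>\<omega>. w t \<omega> - w s \<omega>)" "(\<integral>\<omega>. w t \<omega> - w s \<omega> \<partial>M) = 0"
    and "integrable M (\<lambda>\<omega>. (w t \<omega> - w s \<omega>)\<^sup>2)" "(\<integral>\<omega>. (w t \<omega> - w s \<omega>)\<^sup>2 \<partial>M) = t - s"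
    by auto
qed

text \<open>The earlier increment is measurable at time \<open>c\<close>, the later one is independent of \<open>F c\<close> and centred.\<close>

lemma brownian_increments_uncorrelated:
  assumes basis: "stochastic_basis M F" and w: "brownian_motion M F w"
    and "0 \<le> a" "a \<le> b" "b \<le> c" "c \<le> d"
  shows "integrable M (\<lambda>\<omega>. (w b \<omega> - w a \<omega>) * (w d \<omega> - w c \<omega>))"
    and "(\<integral>\<omega>. (w b \<omega> - w a \<omega>) * (w d \<omega> - w c \<omega>) \<partial>M) = 0"
proof -
  interpret prob_space M
    using basis by (rule stochastic_basisD)
  have "integrable M (\<lambda>\<omega>. (w b \<omega> - w a \<omega>) * (w d \<omega> - w c \<omega>)) \<and>
    (\<integral>\<omega>. (w b \<omega> - w a \<omega>) * (w d \<omega> - w c \<omega>) \<partial>M) = 0"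
  proof (cases "c = d")
    case False
    have meas: "w r \<in> borel_measurable (F c)" if "r = a \<or> r = b" for r
      using that assms by (intro brownian_motion_measurable(1)[OF basis w]) auto
    have rv: "random_variable borel (\<lambda>\<omega>. w b \<omega> - w a \<omega>)" "random_variable borel (\<lambda>\<omega>. w d \<omega> - w c \<omega>)"
      using assms by (auto intro!: borel_measurable_diff brownian_motion_measurable(2)[OF basis w])
    have sub: "subalgebra M (F c)"
      using assms by (intro stochastic_basisD(2)[OF basis]) auto
    have "indep_set (sets (F c)) (sets (vimage_algebra (space M) (\<lambda>\<omega>. w d \<omega> - w c \<omega>) borel))"
      using w assms False by (auto simp: brownian_motion_def)
    moreover have "sigma_sets (space M) {(\<lambda>\<omega>. w b \<omega> - w a \<omega>) -` A \<inter> space M |A. A \<in> sets borel} \<subseteq> sets (F c)"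
    proof -
      have "(\<lambda>\<omega>. w b \<omega> - w a \<omega>) \<in> borel_measurable (F c)"
        by (intro borel_measurable_diff meas) auto
      then have "{(\<lambda>\<omega>. w b \<omega> - w a \<omega>) -` A \<inter> space (F c) |A. A \<in> sets borel} \<subseteq> sets (F c)"
        by (auto intro: measurable_sets)
      moreover have "space (F c) = space M"
        using sub by (simp add: subalgebra_def)
      ultimately show ?thesis
        using sets.sigma_sets_subset[of _ "F c"] by simp
    qed
    ultimately have "indep_set (sigma_sets (space M) {(\<lambda>\<omega>. w b \<omega> - w a \<omega>) -` A \<inter> space M |A. A \<in> sets borel})
      (sigma_sets (space M) {(\<lambda>\<omega>. w d \<omega> - w c \<omega>) -` A \<inter> space M |A. A \<in> sets borel})"
      unfolding indep_sets2_eq sets_vimage_algebra by blast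
    then have "indep_var borel (\<lambda>\<omega>. w b \<omega> - w a \<omega>) borel (\<lambda>\<omega>. w d \<omega> - w c \<omega>)"
      using rv by (simp add: indep_var_eq)
    then show ?thesis
      using brownian_increment_moments(1,2)[OF basis w, of a b]
        brownian_increment_moments(1,2)[OF basis w, of c d] assms
      by (simp add: indep_var_lebesgue_integral indep_var_integrable)
  qed simp
  then show "integrable M (\<lambda>\<omega>. (w b \<omega> - w a \<omega>) * (w d \<omega> - w c \<omega>))"
    "(\<integral>\<omega>. (w b \<omega> - w a \<omega>) * (w d \<omega> - w c \<omega>) \<partial>M) = 0"
    by auto
qed

lemma independent_brownian_increments_uncorrelated:
  assumes basis: "stochastic_basis M F" and w: "independent_brownian_motions M F w"
    and "j \<noteq> k" "0 \<le> a" "a \<le> b" "0 \<le> c" "c \<le> d"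
  shows "integrable M (\<lambda>\<omega>. (w j b \<omega> - w j a \<omega>) * (w k d \<omega> - w k c \<omega>))"
    and "(\<integral>\<omega>. (w j b \<omega> - w j a \<omega>) * (w k d \<omega> - w k c \<omega>) \<partial>M) = 0"
proof -
  interpret prob_space M
    using basis by (rule stochastic_basisD)
  have bm: "brownian_motion M F (w i)" for i
    using w by (simp add: independent_brownian_motions_def)
  have "indep_vars (\<lambda>k. PiM {0..} (\<lambda>t. borel)) (\<lambda>k \<omega>. \<lambda>t\<in>{0..}. w k t \<omega>) {j, k}"
    using w by (intro indep_vars_subset[where J = "{j, k}"]) (auto simp: independent_brownian_motions_def)
  from indep_vars_compose2[OF this, where N = "\<lambda>_. borel" and
      Y = "\<lambda>i x. if i = j then x b - x a else x d - x c"]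
  have ind: "indep_vars (\<lambda>_. borel :: real measure) (\<lambda>i \<omega>. if i = j then w i b \<omega> - w i a \<omega> else w i d \<omega> - w i c \<omega>) {j, k}"
    using assms by (simp cong: if_cong)
  have int: "integrable M (\<lambda>\<omega>. if i = j then w i b \<omega> - w i a \<omega> else w i d \<omega> - w i c \<omega>)" for i
    using brownian_increment_moments(1)[OF basis bm, of a b i]
      brownian_increment_moments(1)[OF basis bm, of c d i] assms by (cases "i = j") simp_all
  show "integrable M (\<lambda>\<omega>. (w j b \<omega> - w j a \<omega>) * (w k d \<omega> - w k c \<omega>))"
    using indep_vars_integrable[OF _ ind int] \<open>j \<noteq> k\<close> by simp
  show "(\<integral>\<omega>. (w j b \<omega> - w j a \<omega>) * (w k d \<omega> - w k c \<omega>) \<partial>M) = 0"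
    using indep_vars_lebesgue_integral[OF _ ind int] \<open>j \<noteq> k\<close>
      brownian_increment_moments(2)[OF basis bm, of a b j] assms by simp
qed

text \<open>Only the coefficients \<open>X p\<close> are orthogonal, in \<open>L\<^sup>2(M)\<close>; the vectors \<open>a p\<close> are arbitrary. This
  matters because the images of the \<open>h\<^sub>k\<close> in the ambient space need not be orthogonal there.\<close>

lemma nn_integral_norm_sum_orthogonal:
  fixes X :: "'i \<Rightarrow> 'a \<Rightarrow> real" and a :: "'i \<Rightarrow> 'x::real_inner"
  assumes "finite I"
    and int: "\<And>p q. p \<in> I \<Longrightarrow> q \<in> I \<Longrightarrow> integrable M (\<lambda>\<omega>. X p \<omega> * X q \<omega>)"
    and orth: "\<And>p q. p \<in> I \<Longrightarrow> q \<in> I \<Longrightarrow> p \<noteq> q \<Longrightarrow> (\<integral>\<omega>. X p \<omega> * X q \<omega> \<partial>M) = 0"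
  shows "(\<integral>\<^sup>+\<omega>. ennreal ((norm (\<Sum>p\<in>I. X p \<omega> *\<^sub>R a p))\<^sup>2) \<partial>M)
    = ennreal (\<Sum>p\<in>I. (\<integral>\<omega>. (X p \<omega>)\<^sup>2 \<partial>M) * (norm (a p))\<^sup>2)"
proof -
  have expand: "(norm (\<Sum>p\<in>I. X p \<omega> *\<^sub>R a p))\<^sup>2 = (\<Sum>p\<in>I. \<Sum>q\<in>I. (X p \<omega> * X q \<omega>) * inner (a p) (a q))" for \<omega>
    unfolding power2_norm_eq_inner
    by (simp add: inner_sum_left inner_sum_right sum_distrib_left mult_ac inner_commute)
  have "(\<integral>\<^sup>+\<omega>. ennreal ((norm (\<Sum>p\<in>I. X p \<omega> *\<^sub>R a p))\<^sup>2) \<partial>M) =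
      ennreal (\<integral>\<omega>. (norm (\<Sum>p\<in>I. X p \<omega> *\<^sub>R a p))\<^sup>2 \<partial>M)"
  proof (rule nn_integral_eq_integral)
    show "integrable M (\<lambda>\<omega>. (norm (\<Sum>p\<in>I. X p \<omega> *\<^sub>R a p))\<^sup>2)"
      unfolding expand by (intro Bochner_Integration.integrable_sum integrable_mult_left int)
  qed simp
  also have "(\<integral>\<omega>. (norm (\<Sum>p\<in>I. X p \<omega> *\<^sub>R a p))\<^sup>2 \<partial>M) =
      (\<Sum>p\<in>I. \<Sum>q\<in>I. (\<integral>\<omega>. X p \<omega> * X q \<omega> \<partial>M) * inner (a p) (a q))"
    unfolding expand by (simp add: int Bochner_Integration.integral_sum)
  also have "\<dots> = (\<Sum>p\<in>I. \<Sum>q\<in>I. if q = p then (\<integral>\<omega>. (X p \<omega>)\<^sup>2 \<partial>M) * (norm (a p))\<^sup>2 else 0)"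
    by (intro sum.cong refl) (auto simp: orth power2_norm_eq_inner power2_eq_square[of "X _ _"])
  also have "\<dots> = (\<Sum>p\<in>I. (\<integral>\<omega>. (X p \<omega>)\<^sup>2 \<partial>M) * (norm (a p))\<^sup>2)"
    using \<open>finite I\<close> by simp
  finally show ?thesis .
qed


section \<open>Completeness and uniqueness of mean-square limits\<close>

text \<open>Completeness of \<open>L\<^sup>2\<close> with values in a complete normed space. Along indices \<open>\<phi> j\<close> with
  \<open>r (\<phi> j) \<le> 4\<^sup>-\<^sup>j\<close> the weighted sum of the squared increments has finite expectation, so the
  sequence converges almost surely; Fatou's lemma turns this into mean-square convergence of the whole
  sequence. The limit is redefined as \<open>0\<close> where the subsequence is not Cauchy, a set that belongs
  to \<open>G\<close>, and so it stays measurable with respect to the smaller \<open>\<sigma>\<close>-algebra.\<close>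

lemma mean_square_Cauchy_limit:
  fixes S :: "nat \<Rightarrow> 'a \<Rightarrow> 'x::{real_normed_vector, polish_space}"
  assumes sub: "subalgebra M G" and S: "\<And>n. S n \<in> borel_measurable G"
    and r: "r \<longlonglongrightarrow> 0" "\<And>n. 0 \<le> r n"
    and bound: "\<And>m n. (\<integral>\<^sup>+\<omega>. ennreal ((norm (S m \<omega> - S n \<omega>))\<^sup>2) \<partial>M) \<le> ennreal (r m + r n)"
  shows "\<exists>U\<in>borel_measurable G. (\<lambda>n. \<integral>\<^sup>+\<omega>. ennreal ((norm (S n \<omega> - U \<omega>))\<^sup>2) \<partial>M) \<longlonglongrightarrow> 0"
proof -
  have SM[measurable]: "S n \<in> borel_measurable M" for n
    using sub S by (rule measurable_from_subalg)
  have "\<exists>n. r n \<le> (1/4) ^ j" for j :: nat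
    using order_tendstoD(2)[OF r(1), of "(1/4) ^ j"]
    by (auto simp: eventually_sequentially intro: less_imp_le)
  then obtain \<phi> :: "nat \<Rightarrow> nat" where \<phi>: "\<And>j. r (\<phi> j) \<le> (1/4) ^ j"
    by metis
  define D where "D j \<omega> = S (\<phi> (Suc j)) \<omega> - S (\<phi> j) \<omega>" for j \<omega>
  have [measurable]: "D j \<in> borel_measurable M" for j
    unfolding D_def by measurable
  \<comment> \<open>the weight \<open>2 ^ j\<close> lets finiteness of the squares imply summability of the norms\<close>
  have "(\<integral>\<^sup>+\<omega>. (\<Sum>j. ennreal (2 ^ j * (norm (D j \<omega>))\<^sup>2)) \<partial>M) =
      (\<Sum>j. \<integral>\<^sup>+\<omega>. ennreal (2 ^ j * (norm (D j \<omega>))\<^sup>2) \<partial>M)"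
    by (intro nn_integral_suminf) measurable
  also have "\<dots> \<le> (\<Sum>j. ennreal (2 * (1/2) ^ j))"
  proof (intro suminf_le summableI)
    fix j
    have "(\<integral>\<^sup>+\<omega>. ennreal (2 ^ j * (norm (D j \<omega>))\<^sup>2) \<partial>M) =
        ennreal (2 ^ j) * (\<integral>\<^sup>+\<omega>. ennreal ((norm (D j \<omega>))\<^sup>2) \<partial>M)"
      by (simp add: ennreal_mult nn_integral_cmult)
    also have "\<dots> \<le> ennreal (2 ^ j) * ennreal (r (\<phi> (Suc j)) + r (\<phi> j))"
      unfolding D_def by (intro mult_left_mono bound) simp
    also have "\<dots> = ennreal (2 ^ j * (r (\<phi> (Suc j)) + r (\<phi> j)))"
      using r by (simp add: ennreal_mult)
    also have "\<dots> \<le> ennreal (2 ^ j * (2 * (1/4) ^ j))"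
    proof -
      have "r (\<phi> (Suc j)) \<le> (1/4) ^ j"
        using \<phi>[of "Suc j"] power_decreasing[of j "Suc j" "1/4::real"] by linarith
      then show ?thesis
        using \<phi>[of j] by (intro ennreal_leI mult_left_mono) auto
    qed
    also have "(2::real) ^ j * (2 * (1/4) ^ j) = 2 * (1/2) ^ j"
      using power_mult_distrib[of "2::real" "1/4" j] by simp
    finally show "(\<integral>\<^sup>+\<omega>. ennreal (2 ^ j * (norm (D j \<omega>))\<^sup>2) \<partial>M) \<le> ennreal (2 * (1/2) ^ j)" .
  qed
  also have "(\<Sum>j. ennreal (2 * (1/2) ^ j)) < \<infinity>"
    by (subst suminf_ennreal2) (auto intro!: summable_mult)
  finally have "AE \<omega> in M. (\<Sum>j. ennreal (2 ^ j * (norm (D j \<omega>))\<^sup>2)) \<noteq> \<infinity>"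
    by (intro nn_integral_PInf_AE) auto
  then have AE_Cauchy: "AE \<omega> in M. Cauchy (\<lambda>j. S (\<phi> j) \<omega>)"
  proof eventually_elim
    case (elim \<omega>)
    then have "summable (\<lambda>j. 2 ^ j * (norm (D j \<omega>))\<^sup>2)"
      by (intro summable_suminf_not_top) auto
    then have "summable (\<lambda>j. 2 ^ j * (norm (D j \<omega>))\<^sup>2 + (1/2) ^ j)"
      by (intro summable_add) auto
    moreover have "norm (D j \<omega>) \<le> 2 ^ j * (norm (D j \<omega>))\<^sup>2 + (1/2) ^ j" for j
    proof -
      have "0 \<le> (2 ^ j * norm (D j \<omega>) - 1)\<^sup>2 / 2 ^ j"
        by simp
      also have "\<dots> = 2 ^ j * (norm (D j \<omega>))\<^sup>2 + (1/2) ^ j - 2 * norm (D j \<omega>)"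
        by (simp add: power2_eq_square field_simps)
      finally show ?thesis
        using norm_ge_zero[of "D j \<omega>"] by linarith
    qed
    ultimately have "summable (\<lambda>j. norm (D j \<omega>))"
      by (intro summable_comparison_test[where f = "\<lambda>j. norm (D j \<omega>)"]) auto
    then have C: "Cauchy (\<lambda>n. \<Sum>j<n. norm (D j \<omega>))"
      by (simp add: summable_iff_convergent convergent_Cauchy)
    have "dist (S (\<phi> p) \<omega>) (S (\<phi> q) \<omega>) \<le> dist (\<Sum>j<p. norm (D j \<omega>)) (\<Sum>j<q. norm (D j \<omega>))" for p q
    proof (induction p q rule: linorder_wlog)
      case (le p q)
      have "S (\<phi> q) \<omega> - S (\<phi> p) \<omega> = (\<Sum>j\<in>{p..<q}. D j \<omega>)"
        unfolding D_def using le sum_Suc_diff'[of p q "\<lambda>j. S (\<phi> j) \<omega>"] by simp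
      then have "dist (S (\<phi> p) \<omega>) (S (\<phi> q) \<omega>) \<le> (\<Sum>j\<in>{p..<q}. norm (D j \<omega>))"
        by (metis dist_commute dist_norm norm_sum)
      also have "\<dots> = (\<Sum>j<q. norm (D j \<omega>)) - (\<Sum>j<p. norm (D j \<omega>))"
        using le by (simp add: lessThan_atLeast0 sum_diff_nat_ivl)
      finally show ?case
        by (simp add: dist_real_def)
    qed (simp add: dist_commute)
    with C show ?case
      unfolding Cauchy_def by (meson le_less_trans)
  qed
  define S' where "S' j \<omega> = (if Cauchy (\<lambda>j. S (\<phi> j) \<omega>) then S (\<phi> j) \<omega> else 0)" for j \<omega>
  define U where "U \<omega> = lim (\<lambda>j. S' j \<omega>)" for \<omega>
  have S'_lim: "(\<lambda>j. S' j \<omega>) \<longlonglongrightarrow> U \<omega>" for \<omega>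
  proof -
    have "Cauchy (\<lambda>j. S' j \<omega>)"
      by (cases "Cauchy (\<lambda>j. S (\<phi> j) \<omega>)") (simp_all add: S'_def convergent_Cauchy convergent_const)
    then show ?thesis
      unfolding U_def by (simp add: Cauchy_convergent_iff convergent_LIMSEQ_iff)
  qed
  have U: "U \<in> borel_measurable G"
  proof (rule borel_measurable_LIMSEQ_metric[OF _ S'_lim])
    note S[measurable]
    show "S' j \<in> borel_measurable G" for j
      unfolding S'_def by measurable
  qed
  then have [measurable]: "U \<in> borel_measurable M"
    by (rule measurable_from_subalg[OF sub])
  have "(\<integral>\<^sup>+\<omega>. ennreal ((norm (S n \<omega> - U \<omega>))\<^sup>2) \<partial>M) \<le> ennreal (r n)" for n
  proof -
    have "AE \<omega> in M. ennreal ((norm (S n \<omega> - U \<omega>))\<^sup>2) =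
        liminf (\<lambda>j. ennreal ((norm (S n \<omega> - S (\<phi> j) \<omega>))\<^sup>2))"
      using AE_Cauchy
    proof eventually_elim
      case (elim \<omega>)
      then have "(\<lambda>j. S (\<phi> j) \<omega>) \<longlonglongrightarrow> U \<omega>"
        using S'_lim[of \<omega>] by (simp add: S'_def)
      then have "(\<lambda>j. ennreal ((norm (S n \<omega> - S (\<phi> j) \<omega>))\<^sup>2)) \<longlonglongrightarrow> ennreal ((norm (S n \<omega> - U \<omega>))\<^sup>2)"
        by (intro tendsto_intros)
      then show ?case
        by (intro lim_imp_Liminf[symmetric]) auto
    qed
    then have "(\<integral>\<^sup>+\<omega>. ennreal ((norm (S n \<omega> - U \<omega>))\<^sup>2) \<partial>M) =
        (\<integral>\<^sup>+\<omega>. liminf (\<lambda>j. ennreal ((norm (S n \<omega> - S (\<phi> j) \<omega>))\<^sup>2)) \<partial>M)"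
      by (rule nn_integral_cong_AE)
    also have "\<dots> \<le> liminf (\<lambda>j. \<integral>\<^sup>+\<omega>. ennreal ((norm (S n \<omega> - S (\<phi> j) \<omega>))\<^sup>2) \<partial>M)"
      by (intro nn_integral_liminf) measurable
    also have "\<dots> \<le> liminf (\<lambda>j. ennreal (r n + (1/4) ^ j))"
      by (intro Liminf_mono always_eventually allI order_trans[OF bound] ennreal_leI add_left_mono \<phi>)
    also have "\<dots> = ennreal (r n)"
    proof (intro lim_imp_Liminf)
      have "(\<lambda>j. ennreal (r n + (1/4) ^ j)) \<longlonglongrightarrow> ennreal (r n + 0)"
        by (intro tendsto_intros LIMSEQ_realpow_zero) auto
      then show "(\<lambda>j. ennreal (r n + (1/4) ^ j)) \<longlonglongrightarrow> ennreal (r n)"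
        by simp
    qed simp
    finally show ?thesis .
  qed
  moreover have "(\<lambda>n. ennreal (r n)) \<longlonglongrightarrow> ennreal 0"
    by (intro tendsto_ennrealI r)
  ultimately have "(\<lambda>n. \<integral>\<^sup>+\<omega>. ennreal ((norm (S n \<omega> - U \<omega>))\<^sup>2) \<partial>M) \<longlonglongrightarrow> 0"
    using tendsto_sandwich[OF _ _ tendsto_const, of 0 _ sequentially "\<lambda>n. ennreal (r n)"] by simp
  with U show ?thesis
    by blast
qed

lemma mean_square_limit_unique:
  fixes S :: "nat \<Rightarrow> 'a \<Rightarrow> 'x::{real_normed_vector, second_countable_topology}"
  assumes [measurable]: "\<And>n. S n \<in> borel_measurable M" "U \<in> borel_measurable M" "U' \<in> borel_measurable M"
    and U: "(\<lambda>n. \<integral>\<^sup>+\<omega>. ennreal ((norm (S n \<omega> - U \<omega>))\<^sup>2) \<partial>M) \<longlonglongrightarrow> 0"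
    and U': "(\<lambda>n. \<integral>\<^sup>+\<omega>. ennreal ((norm (S n \<omega> - U' \<omega>))\<^sup>2) \<partial>M) \<longlonglongrightarrow> 0"
  shows "AE \<omega> in M. U' \<omega> = U \<omega>"
proof -
  let ?d = "\<lambda>n \<omega>. 2 * ennreal ((norm (S n \<omega> - U \<omega>))\<^sup>2) + 2 * ennreal ((norm (S n \<omega> - U' \<omega>))\<^sup>2)"
  have le: "ennreal ((norm (U' \<omega> - U \<omega>))\<^sup>2) \<le> ?d n \<omega>" for n \<omega>
  proof -
    have "norm (U' \<omega> - U \<omega>) \<le> norm (S n \<omega> - U \<omega>) + norm (S n \<omega> - U' \<omega>)"
      using norm_triangle_ineq4[of "S n \<omega> - U \<omega>" "S n \<omega> - U' \<omega>"] by simp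
    then have "(norm (U' \<omega> - U \<omega>))\<^sup>2 \<le> (norm (S n \<omega> - U \<omega>) + norm (S n \<omega> - U' \<omega>))\<^sup>2"
      by (intro power_mono) auto
    also have "\<dots> \<le> 2 * (norm (S n \<omega> - U \<omega>))\<^sup>2 + 2 * (norm (S n \<omega> - U' \<omega>))\<^sup>2"
      using sum_squares_bound[of "norm (S n \<omega> - U \<omega>)" "norm (S n \<omega> - U' \<omega>)"] by (simp add: power2_sum)
    finally have "ennreal ((norm (U' \<omega> - U \<omega>))\<^sup>2) \<le>
        ennreal (2 * (norm (S n \<omega> - U \<omega>))\<^sup>2 + 2 * (norm (S n \<omega> - U' \<omega>))\<^sup>2)"
      by (rule ennreal_leI)
    then show ?thesis
      by (simp add: ennreal_mult)
  qed
  have "(\<integral>\<^sup>+\<omega>. ennreal ((norm (U' \<omega> - U \<omega>))\<^sup>2) \<partial>M) \<le>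
      2 * (\<integral>\<^sup>+\<omega>. ennreal ((norm (S n \<omega> - U \<omega>))\<^sup>2) \<partial>M) + 2 * (\<integral>\<^sup>+\<omega>. ennreal ((norm (S n \<omega> - U' \<omega>))\<^sup>2) \<partial>M)" for n
    using nn_integral_mono[of M "\<lambda>\<omega>. ennreal ((norm (U' \<omega> - U \<omega>))\<^sup>2)", OF le[of _ n]]
    by (simp add: nn_integral_add nn_integral_cmult)
  moreover have "(\<lambda>n. 2 * (\<integral>\<^sup>+\<omega>. ennreal ((norm (S n \<omega> - U \<omega>))\<^sup>2) \<partial>M)
      + 2 * (\<integral>\<^sup>+\<omega>. ennreal ((norm (S n \<omega> - U' \<omega>))\<^sup>2) \<partial>M)) \<longlonglongrightarrow> 2 * 0 + 2 * 0"
    by (intro tendsto_add ennreal_tendsto_cmult U U') simp_all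
  ultimately have "(\<integral>\<^sup>+\<omega>. ennreal ((norm (U' \<omega> - U \<omega>))\<^sup>2) \<partial>M) \<le> 2 * 0 + 2 * 0"
    using LIMSEQ_le_const by blast
  then have "AE \<omega> in M. ennreal ((norm (U' \<omega> - U \<omega>))\<^sup>2) = 0"
    by (subst nn_integral_0_iff_AE[symmetric]) auto
  then show ?thesis
    by eventually_elim (simp add: ennreal_eq_0_iff)
qed

section \<open>Expansions with uniformly bounded kernels\<close>

text \<open>All increments, over different cells or of different Brownian motions, are orthogonal, so the second
  moment is a sum over modes and cells. The constant does not depend on the partition.\<close>

lemma stieltjes_sum_second_moment:
  fixes e :: "nat \<Rightarrow> 'x::real_inner"
  assumes basis: "stochastic_basis M F" and w: "independent_brownian_motions M F w"
    and "finite K" "0 \<le> t"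
    and B: "\<And>k s. k \<in> K \<Longrightarrow> s \<in> {0..t} \<Longrightarrow> (g k s)\<^sup>2 \<le> B"
  shows "(\<integral>\<^sup>+\<omega>. ennreal ((norm (\<Sum>k\<in>K. stieltjes_sum (g k) (\<lambda>s. w k s \<omega>) t n *\<^sub>R e k))\<^sup>2) \<partial>M)
    \<le> ennreal (B * t * (\<Sum>k\<in>K. (norm (e k))\<^sup>2))"
proof (cases "n = 0")
  case True
  then show ?thesis
    by (simp add: stieltjes_sum_def)
next
  case False
  have bm: "brownian_motion M F (w k)" for k
    using w by (simp add: independent_brownian_motions_def)
  define p where "p i = t * real i / real n" for i
  have p_nonneg: "0 \<le> p i" for i
    using \<open>0 \<le> t\<close> by (simp add: p_def)
  have p_mono: "p i \<le> p j" if "i \<le> j" for i j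
    using \<open>0 \<le> t\<close> that by (simp add: p_def divide_right_mono mult_left_mono)
  have p_le: "p i \<le> t" if "i \<le> n" for i
    using p_mono[OF that] False by (simp add: p_def)
  define X where "X q \<omega> = w (fst q) (p (Suc (snd q))) \<omega> - w (fst q) (p (snd q)) \<omega>" for q \<omega>
  define a where "a q = g (fst q) (t - p (snd q)) *\<^sub>R e (fst q)" for q
  have X2: "integrable M (\<lambda>\<omega>. (X q \<omega>)\<^sup>2)" "(\<integral>\<omega>. (X q \<omega>)\<^sup>2 \<partial>M) = t / n" for q
  proof -
    show "integrable M (\<lambda>\<omega>. (X q \<omega>)\<^sup>2)"
      unfolding X_def by (intro brownian_increment_moments[OF basis bm] p_nonneg p_mono) simp
    have "(\<integral>\<omega>. (X q \<omega>)\<^sup>2 \<partial>M) = p (Suc (snd q)) - p (snd q)"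
      unfolding X_def by (intro brownian_increment_moments[OF basis bm] p_nonneg p_mono) simp
    then show "(\<integral>\<omega>. (X q \<omega>)\<^sup>2 \<partial>M) = t / n"
      by (simp add: p_def field_simps add_divide_distrib)
  qed
  have cross: "integrable M (\<lambda>\<omega>. X q \<omega> * X q' \<omega>) \<and> (\<integral>\<omega>. X q \<omega> * X q' \<omega> \<partial>M) = 0" if "q \<noteq> q'" for q q'
  proof (cases "fst q = fst q'")
    case False
    then show ?thesis
      unfolding X_def
      by (intro conjI independent_brownian_increments_uncorrelated[OF basis w] p_nonneg p_mono) auto
  next
    case True
    have *: "integrable M (\<lambda>\<omega>. X q \<omega> * X q' \<omega>) \<and> (\<integral>\<omega>. X q \<omega> * X q' \<omega> \<partial>M) = 0"
      if "fst q = fst q'" "snd q < snd q'" for q q'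
      unfolding X_def \<open>fst q = fst q'\<close> using that
      by (intro conjI brownian_increments_uncorrelated[OF basis bm] p_nonneg p_mono) auto
    show ?thesis
      using *[of q q'] *[of q' q] True that prod_eq_iff[of q q']
      by (cases "snd q" "snd q'" rule: linorder_cases) (auto simp: mult.commute)
  qed
  have "(\<Sum>k\<in>K. stieltjes_sum (g k) (\<lambda>s. w k s \<omega>) t n *\<^sub>R e k) = (\<Sum>q\<in>K \<times> {..<n}. X q \<omega> *\<^sub>R a q)" for \<omega>
    by (simp add: sum.cartesian_product' stieltjes_sum_def X_def a_def p_def scaleR_sum_left mult.commute)
  then have "(\<integral>\<^sup>+\<omega>. ennreal ((norm (\<Sum>k\<in>K. stieltjes_sum (g k) (\<lambda>s. w k s \<omega>) t n *\<^sub>R e k))\<^sup>2) \<partial>M) =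
      (\<integral>\<^sup>+\<omega>. ennreal ((norm (\<Sum>q\<in>K \<times> {..<n}. X q \<omega> *\<^sub>R a q))\<^sup>2) \<partial>M)"
    by simp
  also have "\<dots> = ennreal (\<Sum>q\<in>K \<times> {..<n}. (\<integral>\<omega>. (X q \<omega>)\<^sup>2 \<partial>M) * (norm (a q))\<^sup>2)"
  proof (rule nn_integral_norm_sum_orthogonal)
    show "integrable M (\<lambda>\<omega>. X q \<omega> * X q' \<omega>)" for q q'
      using cross[of q q'] X2(1)[of q] by (cases "q = q'") (auto simp: power2_eq_square)
  qed (use \<open>finite K\<close> cross in auto)
  also have "(\<Sum>q\<in>K \<times> {..<n}. (\<integral>\<omega>. (X q \<omega>)\<^sup>2 \<partial>M) * (norm (a q))\<^sup>2) =
      (\<Sum>k\<in>K. \<Sum>i<n. t / n * ((g k (t - p i))\<^sup>2 * (norm (e k))\<^sup>2))"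
    unfolding X2 by (simp add: sum.cartesian_product' a_def power_mult_distrib)
  also have "\<dots> \<le> (\<Sum>k\<in>K. \<Sum>i<n. t / n * (B * (norm (e k))\<^sup>2))"
    using \<open>0 \<le> t\<close> p_le p_nonneg by (intro sum_mono mult_left_mono mult_right_mono B) auto
  also have "\<dots> = B * t * (\<Sum>k\<in>K. (norm (e k))\<^sup>2)"
    using False by (simp add: sum_distrib_left mult_ac)
  finally show ?thesis
    by (simp add: ennreal_leI)
qed

lemma stieltjes_sum_measurable:
  assumes "stochastic_basis M F" "brownian_motion M F w" "0 \<le> t"
  shows "(\<lambda>\<omega>. stieltjes_sum g (\<lambda>s. w s \<omega>) t n) \<in> borel_measurable (F t)"
proof -
  have "t * real i / real n \<in> {0..t}" if "i \<le> n" for i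
    using \<open>0 \<le> t\<close> that mult_left_mono[of "real i" "real n" t]
    by (cases "n = 0") (auto simp: pos_divide_le_eq)
  then have "w (t * real i / real n) \<in> borel_measurable (F t)" if "i \<le> n" for i
    using brownian_motion_measurable(1)[OF assms(1,2), of "t * real i / real n" t] that by auto
  then have "w (t * real i / real n) \<in> borel_measurable (F t)"
    "w (t * real (Suc i) / real n) \<in> borel_measurable (F t)" if "i < n" for i
    using that by (meson Suc_leI less_imp_le)+
  then show ?thesis
    unfolding stieltjes_sum_def
    by (intro borel_measurable_sum borel_measurable_times borel_measurable_diff borel_measurable_const) simp_all
qed

text \<open>Fatou's lemma carries the bound over from the elementary integrals. Orthogonality of
  different modes is used before the limit, where it is a property of finitely many increments.\<close>

lemma stochastic_integral_sum_second_moment: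
  fixes e :: "nat \<Rightarrow> 'x::{real_inner, second_countable_topology}"
  assumes basis: "stochastic_basis M F" and w: "independent_brownian_motions M F w"
    and "finite K" "0 \<le> t"
    and B: "\<And>k s. k \<in> K \<Longrightarrow> s \<in> {0..t} \<Longrightarrow> (g k s)\<^sup>2 \<le> B"
    and lim: "\<And>k. k \<in> K \<Longrightarrow> AE \<omega> in M. stieltjes_sum (g k) (\<lambda>s. w k s \<omega>) t \<longlonglongrightarrow> y k \<omega>"
  shows "(\<integral>\<^sup>+\<omega>. ennreal ((norm (\<Sum>k\<in>K. y k \<omega> *\<^sub>R e k))\<^sup>2) \<partial>M)
    \<le> ennreal (B * t * (\<Sum>k\<in>K. (norm (e k))\<^sup>2))"
proof -
  let ?S = "\<lambda>n \<omega>. ennreal ((norm (\<Sum>k\<in>K. stieltjes_sum (g k) (\<lambda>s. w k s \<omega>) t n *\<^sub>R e k))\<^sup>2)"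
  have [measurable]: "(\<lambda>\<omega>. stieltjes_sum (g k) (\<lambda>s. w k s \<omega>) t n) \<in> borel_measurable M" for k n
    using w \<open>0 \<le> t\<close>
    by (intro stochastic_basisD(4)[OF basis \<open>0 \<le> t\<close>] stieltjes_sum_measurable[OF basis])
      (auto simp: independent_brownian_motions_def)
  have "AE \<omega> in M. \<forall>k\<in>K. stieltjes_sum (g k) (\<lambda>s. w k s \<omega>) t \<longlonglongrightarrow> y k \<omega>"
    using lim \<open>finite K\<close> by (intro AE_finite_allI) auto
  then have "AE \<omega> in M. ennreal ((norm (\<Sum>k\<in>K. y k \<omega> *\<^sub>R e k))\<^sup>2) = liminf (\<lambda>n. ?S n \<omega>)"
  proof eventually_elim
    case (elim \<omega>)
    then have "(\<lambda>n. ?S n \<omega>) \<longlonglongrightarrow> ennreal ((norm (\<Sum>k\<in>K. y k \<omega> *\<^sub>R e k))\<^sup>2)"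
      by (intro tendsto_intros) auto
    then show ?case
      by (intro lim_imp_Liminf[symmetric]) auto
  qed
  then have "(\<integral>\<^sup>+\<omega>. ennreal ((norm (\<Sum>k\<in>K. y k \<omega> *\<^sub>R e k))\<^sup>2) \<partial>M) = (\<integral>\<^sup>+\<omega>. liminf (\<lambda>n. ?S n \<omega>) \<partial>M)"
    by (rule nn_integral_cong_AE)
  also have "\<dots> \<le> liminf (\<lambda>n. \<integral>\<^sup>+\<omega>. ?S n \<omega> \<partial>M)"
    by (intro nn_integral_liminf) measurable
  also have "\<dots> \<le> liminf (\<lambda>n. ennreal (B * t * (\<Sum>k\<in>K. (norm (e k))\<^sup>2)))"
    using assms by (intro Liminf_mono always_eventually allI stieltjes_sum_second_moment) auto
  also have "\<dots> = ennreal (B * t * (\<Sum>k\<in>K. (norm (e k))\<^sup>2))"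
    by (simp add: Liminf_const)
  finally show ?thesis .
qed

text \<open>The partial sums are Cauchy because the second moment of a block is at most \<open>B t\<close> times the
  corresponding block of the convergent series of the \<open>\<parallel>e\<^sub>k\<parallel>\<^sup>2\<close>.\<close>

lemma mean_square_expansion_exists:
  fixes e :: "nat \<Rightarrow> 'x::{real_inner, polish_space}"
  assumes basis: "stochastic_basis M F" and w: "independent_brownian_motions M F w"
    and e: "summable (\<lambda>k. (norm (e k))\<^sup>2)"
    and y: "\<And>k. adapted_on T F (y k)"
    and lim: "\<And>k t. t \<in> {0..T} \<Longrightarrow> AE \<omega> in M. stieltjes_sum (g k) (\<lambda>s. w k s \<omega>) t \<longlonglongrightarrow> y k t \<omega>"
    and B: "\<And>k s. s \<in> {0..T} \<Longrightarrow> (g k s)\<^sup>2 \<le> B"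
  shows "\<exists>Y. adapted_on T F Y \<and> mean_square_expansion M T e Y y"
proof -
  let ?S = "\<lambda>t n \<omega>. \<Sum>k<n. y k t \<omega> *\<^sub>R e k"
  have "\<exists>U\<in>borel_measurable (F t). (\<lambda>n. \<integral>\<^sup>+\<omega>. ennreal ((norm (?S t n \<omega> - U \<omega>))\<^sup>2) \<partial>M) \<longlonglongrightarrow> 0"
    if t: "t \<in> {0..T}" for t
  proof (rule mean_square_Cauchy_limit)
    show "subalgebra M (F t)"
      using t by (intro stochastic_basisD(2)[OF basis]) auto
    have [measurable]: "y k t \<in> borel_measurable (F t)" for k
      using y t by (simp add: adapted_on_def)
    show "?S t n \<in> borel_measurable (F t)" for n
      by measurable
    \<comment> \<open>\<open>B t\<close> times the tail of the series of the \<open>\<parallel>e\<^sub>k\<parallel>\<^sup>2\<close>\<close>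
    define r where "r n = B * t * ((\<Sum>k. (norm (e k))\<^sup>2) - (\<Sum>k<n. (norm (e k))\<^sup>2))" for n
    have "0 \<le> (g 0 t)\<^sup>2"
      by simp
    then have "0 \<le> B"
      using B[OF t, of 0] by linarith
    then show r_nonneg: "0 \<le> r n" for n
      using t sum_le_suminf[OF e, of "{..<n}"] by (simp add: r_def)
    have "r \<longlonglongrightarrow> B * t * ((\<Sum>k. (norm (e k))\<^sup>2) - (\<Sum>k. (norm (e k))\<^sup>2))"
      unfolding r_def by (intro tendsto_intros summable_LIMSEQ e)
    then show "r \<longlonglongrightarrow> 0"
      by simp
    show "(\<integral>\<^sup>+\<omega>. ennreal ((norm (?S t m \<omega> - ?S t n \<omega>))\<^sup>2) \<partial>M) \<le> ennreal (r m + r n)" for m n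
    proof (induction m n rule: linorder_wlog)
      case (le m n)
      have "norm (?S t m \<omega> - ?S t n \<omega>) = norm (\<Sum>k\<in>{m..<n}. y k t \<omega> *\<^sub>R e k)" for \<omega>
        using sum_diff_nat_ivl[of 0 m n "\<lambda>k. y k t \<omega> *\<^sub>R e k"] le
        by (subst norm_minus_commute) (simp add: lessThan_atLeast0)
      then have "(\<integral>\<^sup>+\<omega>. ennreal ((norm (?S t m \<omega> - ?S t n \<omega>))\<^sup>2) \<partial>M) =
          (\<integral>\<^sup>+\<omega>. ennreal ((norm (\<Sum>k\<in>{m..<n}. y k t \<omega> *\<^sub>R e k))\<^sup>2) \<partial>M)"
        by simp
      also have "\<dots> \<le> ennreal (B * t * (\<Sum>k\<in>{m..<n}. (norm (e k))\<^sup>2))"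
        using t by (intro stochastic_integral_sum_second_moment[OF basis w, where g = g] lim B) auto
      also have "B * t * (\<Sum>k\<in>{m..<n}. (norm (e k))\<^sup>2) = r m - r n"
        using sum_diff_nat_ivl[of 0 m n "\<lambda>k. (norm (e k))\<^sup>2"] le
        by (simp add: r_def lessThan_atLeast0 algebra_simps)
      also have "ennreal (r m - r n) \<le> ennreal (r m + r n)"
        using r_nonneg[of n] by (intro ennreal_leI) simp
      finally show ?case .
    next
      case (sym m n)
      then show ?case
        by (simp add: norm_minus_commute add.commute)
    qed
  qed
  then have "\<forall>t\<in>{0..T}. \<exists>U. U \<in> borel_measurable (F t) \<and>
      (\<lambda>n. \<integral>\<^sup>+\<omega>. ennreal ((norm (?S t n \<omega> - U \<omega>))\<^sup>2) \<partial>M) \<longlonglongrightarrow> 0"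
    by blast
  from bchoice[OF this] obtain Y where "\<forall>t\<in>{0..T}. Y t \<in> borel_measurable (F t) \<and>
      (\<lambda>n. \<integral>\<^sup>+\<omega>. ennreal ((norm (?S t n \<omega> - Y t \<omega>))\<^sup>2) \<partial>M) \<longlonglongrightarrow> 0" ..
  then show ?thesis
    by (intro exI[of _ Y]) (auto simp: adapted_on_def mean_square_expansion_def)
qed

section \<open>Bounds on the kernels of a hyperbolic equation\<close>

lemma incseq_unbounded_at_top:
  fixes a :: "nat \<Rightarrow> real"
  assumes "incseq a" "\<not> bdd_above (range a)"
  shows "filterlim a at_top sequentially"
  unfolding filterlim_at_top
proof
  fix Z
  obtain N where "Z < a N"
    using assms(2) unfolding bdd_above_def by (auto simp: not_le)
  then show "\<forall>\<^sub>F n in sequentially. Z \<le> a n"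
    using incseqD[OF assms(1)] by (intro eventually_sequentiallyI[of N]) (meson less_imp_le order_trans)
qed

text \<open>The asymptotic form in which hyperbolicity enters the kernel bounds: eigenvalues \<open>\<lambda>\<^sub>k\<close> tending
  to infinity, and an upper bound of logarithmic size on the \<open>\<mu>\<^sub>k\<close>.\<close>

lemma hyperbolicD:
  assumes "hyperbolic T \<Theta>1 \<Theta>2 \<kappa> \<tau> \<rho> \<nu>" "\<theta>1 \<in> \<Theta>1" "\<theta>2 \<in> \<Theta>2"
  shows "filterlim (eig \<kappa> \<tau> \<theta>1) at_top sequentially"
    and "\<exists>C. \<forall>\<^sub>F k in sequentially. T * eig \<rho> \<nu> \<theta>2 k \<le> ln (eig \<kappa> \<tau> \<theta>1 k) + C"
proof -
  have "\<exists>Cs. incseq (\<lambda>k. eig \<kappa> \<tau> \<theta>1 k + Cs) \<and> \<not> bdd_above (range (\<lambda>k. eig \<kappa> \<tau> \<theta>1 k + Cs))"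
    using assms unfolding hyperbolic_def by meson
  then obtain Cs where "incseq (\<lambda>k. eig \<kappa> \<tau> \<theta>1 k + Cs) \<and> \<not> bdd_above (range (\<lambda>k. eig \<kappa> \<tau> \<theta>1 k + Cs))" ..
  then have "filterlim (\<lambda>k. eig \<kappa> \<tau> \<theta>1 k + Cs) at_top sequentially"
    by (intro incseq_unbounded_at_top) auto
  from filterlim_tendsto_add_at_top[OF tendsto_const[of "- Cs"] this]
  show "filterlim (eig \<kappa> \<tau> \<theta>1) at_top sequentially"
    by simp
  show "\<exists>C. \<forall>\<^sub>F k in sequentially. T * eig \<rho> \<nu> \<theta>2 k \<le> ln (eig \<kappa> \<tau> \<theta>1 k) + C"
    using assms unfolding hyperbolic_def eventually_sequentially by meson
qed

text \<open>The finitely many exceptional kernels are bounded by compactness.\<close>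

lemma eventually_bounded_imp_uniformly_bounded:
  fixes g :: "nat \<Rightarrow> real \<Rightarrow> real"
  assumes cont: "\<And>k. continuous_on {a..b} (g k)"
    and ev: "\<forall>\<^sub>F k in sequentially. \<forall>s\<in>{a..b}. (g k s)\<^sup>2 \<le> B"
  shows "\<exists>B'. \<forall>k. \<forall>s\<in>{a..b}. (g k s)\<^sup>2 \<le> B'"
proof -
  obtain N where N: "\<And>k s. N \<le> k \<Longrightarrow> s \<in> {a..b} \<Longrightarrow> (g k s)\<^sup>2 \<le> B"
    using ev unfolding eventually_sequentially by blast
  have "\<exists>c. \<forall>s\<in>{a..b}. (g k s)\<^sup>2 \<le> c" for k
  proof -
    have "bounded ((\<lambda>s. (g k s)\<^sup>2) ` {a..b})"
      by (intro compact_imp_bounded compact_continuous_image continuous_intros cont compact_Icc)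
    then show ?thesis
      by (auto simp: bounded_iff)
  qed
  then obtain c where c: "\<And>k s. s \<in> {a..b} \<Longrightarrow> (g k s)\<^sup>2 \<le> c k"
    by metis
  have "(g k s)\<^sup>2 \<le> \<bar>B\<bar> + (\<Sum>j<N. \<bar>c j\<bar>)" if "s \<in> {a..b}" for k s
  proof (cases "k < N")
    case True
    have "(g k s)\<^sup>2 \<le> \<bar>c k\<bar>"
      using c[OF that, of k] by simp
    also have "\<dots> \<le> (\<Sum>j<N. \<bar>c j\<bar>)"
      using True by (intro member_le_sum) auto
    finally show ?thesis by simp
  next
    case False
    have "0 \<le> (\<Sum>j<N. \<bar>c j\<bar>)"
      by (intro sum_nonneg) simp
    then show ?thesis
      using N[of k s] False that by linarith
  qed
  then show ?thesis by blast
qed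

text \<open>For \<open>m > 0\<close> the damped energy gives \<open>(l - m\<^sup>2 / 4) f\<^sup>2 \<le> exp (m t)\<close>. Hyperbolicity bounds the right-hand
  side by \<open>l exp C\<close>, and it makes \<open>m\<close> at most of order \<open>ln l\<close>, so that \<open>l - m\<^sup>2 / 4 \<ge> l / 2\<close>: the factors \<open>l\<close>
  cancel. This is where the logarithm in the definition of hyperbolicity is used to full strength.\<close>

lemma hyperbolic_kernel_bound:
  assumes ker: "oscillator_kernel l m f f'" and "0 < T" "t \<in> {0..T}" "1 \<le> l" "0 \<le> C"
    and hyp: "T * m \<le> ln l + C" and large: "(ln l + C)\<^sup>2 \<le> 2 * T\<^sup>2 * l"
  shows "(f t)\<^sup>2 \<le> 2 * exp C"
proof (cases "m \<le> 0")
  case True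
  have "(f t)\<^sup>2 \<le> l * (f t)\<^sup>2"
    using \<open>1 \<le> l\<close> by (simp add: mult_le_cancel_right1)
  also have "\<dots> \<le> (f' t)\<^sup>2 + l * (f t)\<^sup>2"
    by simp
  also have "\<dots> \<le> 1"
    using oscillator_kernel_energy_le[OF ker, of 0 t] True assms by simp
  also have "1 \<le> 2 * exp C"
    using \<open>0 \<le> C\<close> one_le_exp_iff[of C] by linarith
  finally show ?thesis .
next
  case False
  have "T\<^sup>2 * m\<^sup>2 \<le> (ln l + C)\<^sup>2"
    using hyp False \<open>0 < T\<close> power_mono[of "T * m" "ln l + C" 2] by (simp add: power_mult_distrib)
  also note large
  finally have "T\<^sup>2 * m\<^sup>2 \<le> T\<^sup>2 * (2 * l)"
    by simp
  then have "m\<^sup>2 \<le> 2 * l"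
    using \<open>0 < T\<close> by simp
  then have "l / 2 * (f t)\<^sup>2 \<le> (l - m\<^sup>2 / 4) * (f t)\<^sup>2"
    by (intro mult_right_mono) auto
  also have "\<dots> \<le> exp (m * t)"
    unfolding oscillator_kernel_damped_energy[OF ker, of t, symmetric] by simp
  also have "\<dots> \<le> exp (ln l + C)"
  proof -
    have "m * t \<le> T * m"
      using False \<open>t \<in> {0..T}\<close> by (simp add: mult.commute[of T] mult_left_mono)
    then show ?thesis
      using hyp by simp
  qed
  also have "\<dots> = l / 2 * (2 * exp C)"
    using \<open>1 \<le> l\<close> by (simp add: exp_add)
  finally show ?thesis
    using \<open>1 \<le> l\<close> by (simp add: mult_le_cancel_left_pos)
qed

lemma hyperbolic_kernels_bounded:
  assumes ker: "\<And>k. oscillator_kernel (l k) (m k) (f k) (f' k)" and "0 < T"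
    and l: "filterlim l at_top sequentially"
    and m: "\<forall>\<^sub>F k in sequentially. T * m k \<le> ln (l k) + C"
  shows "\<exists>B. \<forall>k. \<forall>s\<in>{0..T}. (f k s)\<^sup>2 \<le> B"
proof (rule eventually_bounded_imp_uniformly_bounded)
  show "continuous_on {0..T} (f k)" for k
    by (rule oscillator_kernel_continuous(1)[OF ker continuous_on_id])
  have "\<forall>\<^sub>F x in at_top. (ln x + \<bar>C\<bar>)\<^sup>2 \<le> 2 * T\<^sup>2 * x"
    using \<open>0 < T\<close> by real_asymp
  from eventually_compose_filterlim[OF this l] eventually_compose_filterlim[OF eventually_ge_at_top[of 1] l] m
  show "\<forall>\<^sub>F k in sequentially. \<forall>s\<in>{0..T}. (f k s)\<^sup>2 \<le> 2 * exp \<bar>C\<bar>"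
  proof eventually_elim
    case (elim k)
    then show ?case
      using hyperbolic_kernel_bound[OF ker \<open>0 < T\<close>, of _ k "\<bar>C\<bar>"] by force
  qed
qed

lemma kernel_derivatives_bounded:
  assumes ker: "\<And>k. oscillator_kernel (l k) (m k) (f k) (f' k)"
    and l: "filterlim l at_top sequentially" and m: "\<And>k. m k \<le> C"
  shows "\<exists>B. \<forall>k. \<forall>s\<in>{0..T}. (f' k s)\<^sup>2 \<le> B"
proof (rule eventually_bounded_imp_uniformly_bounded)
  show "continuous_on {0..T} (f' k)" for k
    by (rule oscillator_kernel_continuous(2)[OF ker continuous_on_id])
  show "\<forall>\<^sub>F k in sequentially. \<forall>s\<in>{0..T}. (f' k s)\<^sup>2 \<le> exp (2 * \<bar>C\<bar> * T)"
    using eventually_compose_filterlim[OF eventually_ge_at_top[of 0] l]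
  proof eventually_elim
    case (elim k)
    show ?case
    proof
      fix s
      assume s: "s \<in> {0..T}"
      have "(f' k s)\<^sup>2 \<le> (f' k s)\<^sup>2 + l k * (f k s)\<^sup>2"
        using elim by simp
      also have "\<dots> \<le> exp (2 * \<bar>C\<bar> * s)"
        using s elim m[of k] by (intro oscillator_kernel_energy_le[OF ker]) auto
      also have "\<dots> \<le> exp (2 * \<bar>C\<bar> * T)"
        using s by (simp add: mult_left_mono)
      finally show "(f' k s)\<^sup>2 \<le> exp (2 * \<bar>C\<bar> * T)" .
    qed
  qed
qed

section \<open>Existence and uniqueness of the generalized solution\<close>

text \<open>Defined for every \<open>\<omega>\<close>, with an unspecified value where the sums diverge. As a limit of adapted
  sums it is then adapted.\<close>

definition wiener_integral :: "(real \<Rightarrow> real) \<Rightarrow> (real \<Rightarrow> 'w \<Rightarrow> real) \<Rightarrow> real \<Rightarrow> 'w \<Rightarrow> real" where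
  "wiener_integral g w t \<omega> = lim (stieltjes_sum g (\<lambda>s. w s \<omega>) t)"

lemma wiener_integral_adapted:
  assumes "stochastic_basis M F" "brownian_motion M F w"
  shows "adapted_on T F (wiener_integral g w)"
  unfolding adapted_on_def
proof
  fix t
  assume "t \<in> {0..T}"
  then have "(\<lambda>\<omega>. stieltjes_sum g (\<lambda>s. w s \<omega>) t n) \<in> borel_measurable (F t)" for n
    by (intro stieltjes_sum_measurable[OF assms]) auto
  then have "(\<lambda>\<omega>. lim (\<lambda>n. stieltjes_sum g (\<lambda>s. w s \<omega>) t n)) \<in> borel_measurable (F t)"
    by (rule borel_measurable_lim_metric)
  then show "wiener_integral g w t \<in> borel_measurable (F t)"
    by (simp add: wiener_integral_def[abs_def])
qed

lemma wiener_integral_path: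
  assumes ker: "oscillator_kernel l m f f'" and bm: "brownian_motion M F w"
  shows "AE \<omega> in M. \<exists>u v. continuous_on {0..T} u \<and> continuous_on {0..T} v \<and>
     (\<forall>t\<in>{0..T}. wiener_integral f w t \<omega> = u t \<and> wiener_integral f' w t \<omega> = v t \<and>
        stieltjes_sum f (\<lambda>s. w s \<omega>) t \<longlonglongrightarrow> wiener_integral f w t \<omega> \<and>
        stieltjes_sum f' (\<lambda>s. w s \<omega>) t \<longlonglongrightarrow> wiener_integral f' w t \<omega> \<and>
        u t = (LINT s:{0..t}|lborel. v s) \<and>
        v t = (LINT s:{0..t}|lborel. - l * u s + m * v s) + w t \<omega>)"
proof -
  have "AE \<omega> in M. w 0 \<omega> = 0" "AE \<omega> in M. continuous_on {0..} (\<lambda>t. w t \<omega>)"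
    using bm by (auto simp: brownian_motion_def)
  then show ?thesis
  proof eventually_elim
    case (elim \<omega>)
    then have "continuous_on {0..T} (\<lambda>t. w t \<omega>)"
      by (auto intro: continuous_on_subset)
    from driven_oscillator_path[OF ker this elim(1)] obtain u v
      where cont: "continuous_on {0..T} u" "continuous_on {0..T} v"
        and path: "\<forall>t\<in>{0..T}. stieltjes_sum f (\<lambda>s. w s \<omega>) t \<longlonglongrightarrow> u t \<and>
          stieltjes_sum f' (\<lambda>s. w s \<omega>) t \<longlonglongrightarrow> v t \<and>
          u t = (LINT s:{0..t}|lborel. v s) \<and>
          v t = (LINT s:{0..t}|lborel. - l * u s + m * v s) + w t \<omega>"
      by (elim exE conjE)
    have eq: "wiener_integral f w t \<omega> = u t" "wiener_integral f' w t \<omega> = v t" if "t \<in> {0..T}" for t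
      using path that unfolding wiener_integral_def by (blast intro: limI)+
    show ?case
    proof (rule exI[of _ u], rule exI[of _ v], intro conjI[OF cont(1)] conjI[OF cont(2)] ballI)
      fix t
      assume t: "t \<in> {0..T}"
      show "wiener_integral f w t \<omega> = u t \<and> wiener_integral f' w t \<omega> = v t \<and>
          stieltjes_sum f (\<lambda>s. w s \<omega>) t \<longlonglongrightarrow> wiener_integral f w t \<omega> \<and>
          stieltjes_sum f' (\<lambda>s. w s \<omega>) t \<longlonglongrightarrow> wiener_integral f' w t \<omega> \<and>
          u t = (LINT s:{0..t}|lborel. v s) \<and>
          v t = (LINT s:{0..t}|lborel. - l * u s + m * v s) + w t \<omega>"
        unfolding eq[OF t] using path t by blast
    qed
  qed
qed

lemma wiener_integral_oscillator_solution:
  assumes ker: "oscillator_kernel l m f f'" and basis: "stochastic_basis M F" and bm: "brownian_motion M F w"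
  shows "oscillator_solution M F T l m w (wiener_integral f w) (wiener_integral f' w)"
  unfolding oscillator_solution_def
proof (intro conjI wiener_integral_adapted[OF basis bm])
  let ?u = "wiener_integral f w" and ?v = "wiener_integral f' w"
  show "AE \<omega> in M. set_integrable lborel {0..T} (\<lambda>s. ?u s \<omega>) \<and> set_integrable lborel {0..T} (\<lambda>s. ?v s \<omega>) \<and>
      (\<forall>t\<in>{0..T}. ?u t \<omega> = (LINT s:{0..t}|lborel. ?v s \<omega>) \<and>
        ?v t \<omega> = (LINT s:{0..t}|lborel. - l * ?u s \<omega> + m * ?v s \<omega>) + w t \<omega>)"
    using wiener_integral_path[OF ker bm, of T]
  proof eventually_elim
    case (elim \<omega>)
    then obtain u v where cont: "continuous_on {0..T} u" "continuous_on {0..T} v"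
      and eq: "\<And>t. t \<in> {0..T} \<Longrightarrow> ?u t \<omega> = u t" "\<And>t. t \<in> {0..T} \<Longrightarrow> ?v t \<omega> = v t"
      and path: "\<And>t. t \<in> {0..T} \<Longrightarrow> u t = (LINT s:{0..t}|lborel. v s) \<and>
        v t = (LINT s:{0..t}|lborel. - l * u s + m * v s) + w t \<omega>"
      by auto
    show ?case
    proof (intro conjI ballI)
      show "set_integrable lborel {0..T} (\<lambda>s. ?u s \<omega>)" "set_integrable lborel {0..T} (\<lambda>s. ?v s \<omega>)"
      proof -
        have "set_integrable lborel {0..T} (\<lambda>s. ?u s \<omega>) = set_integrable lborel {0..T} u"
          "set_integrable lborel {0..T} (\<lambda>s. ?v s \<omega>) = set_integrable lborel {0..T} v"
          by (intro set_integrable_cong refl eq, assumption)+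
        then show "set_integrable lborel {0..T} (\<lambda>s. ?u s \<omega>)" "set_integrable lborel {0..T} (\<lambda>s. ?v s \<omega>)"
          using cont[THEN borel_integrable_atLeastAtMost'] by simp_all
      qed
      fix t
      assume t: "t \<in> {0..T}"
      have "(LINT s:{0..t}|lborel. ?v s \<omega>) = (LINT s:{0..t}|lborel. v s)"
        "(LINT s:{0..t}|lborel. - l * ?u s \<omega> + m * ?v s \<omega>) = (LINT s:{0..t}|lborel. - l * u s + m * v s)"
        using t eq by (auto intro!: set_lebesgue_integral_cong)
      then show "?u t \<omega> = (LINT s:{0..t}|lborel. ?v s \<omega>)"
        "?v t \<omega> = (LINT s:{0..t}|lborel. - l * ?u s \<omega> + m * ?v s \<omega>) + w t \<omega>"
        using path[OF t] eq[OF t] by simp_all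
    qed
  qed
qed

text \<open>The noise is additive, so the difference of two solutions solves the homogeneous system path by path.\<close>

lemma oscillator_solution_unique:
  assumes "oscillator_solution M F T l m w u v" "oscillator_solution M F T l m w u' v'"
  shows "AE \<omega> in M. \<forall>t\<in>{0..T}. u' t \<omega> = u t \<omega>"
proof -
  let ?sol = "\<lambda>u v \<omega>. set_integrable lborel {0..T} (\<lambda>s. u s \<omega>) \<and>
      set_integrable lborel {0..T} (\<lambda>s. v s \<omega>) \<and>
      (\<forall>t\<in>{0..T}. u t \<omega> = (LINT s:{0..t}|lborel. v s \<omega>) \<and>
         v t \<omega> = (LINT s:{0..t}|lborel. - l * u s \<omega> + m * v s \<omega>) + w t \<omega>)"
  have "AE \<omega> in M. ?sol u v \<omega>" "AE \<omega> in M. ?sol u' v' \<omega>"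
    using assms unfolding oscillator_solution_def by blast+
  then show ?thesis
  proof eventually_elim
    case (elim \<omega>)
    note int = elim(1)[THEN conjunct1] elim(1)[THEN conjunct2, THEN conjunct1]
      elim(2)[THEN conjunct1] elim(2)[THEN conjunct2, THEN conjunct1]
    have sub: "set_integrable lborel {0..t} f" if "set_integrable lborel {0..T} f" "t \<in> {0..T}"
      for t and f :: "real \<Rightarrow> real"
      using that by (intro set_integrable_subset[OF that(1)]) auto
    show ?case
    proof
      fix t
      assume t: "t \<in> {0..T}"
      have "u' t \<omega> - u t \<omega> = 0 \<and> v' t \<omega> - v t \<omega> = 0"
      proof (rule homogeneous_oscillator_unique[where T = T and l = l and m = m
            and a = "\<lambda>t. u' t \<omega> - u t \<omega>" and b = "\<lambda>t. v' t \<omega> - v t \<omega>"])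
        show "set_integrable lborel {0..T} (\<lambda>s. u' s \<omega> - u s \<omega>)"
          "set_integrable lborel {0..T} (\<lambda>s. v' s \<omega> - v s \<omega>)"
          using int by (auto intro: set_integral_diff(1))
        fix s
        assume s: "s \<in> {0..T}"
        note i = int[THEN sub, OF s]
        have L: "set_integrable lborel {0..s} (\<lambda>r. - l * f r + m * g r)"
          if "set_integrable lborel {0..s} f" "set_integrable lborel {0..s} g" for f g :: "real \<Rightarrow> real"
          by (rule set_integral_add(1)[OF set_integrable_mult_right set_integrable_mult_right])
            (rule that)+
        show "u' s \<omega> - u s \<omega> = (LINT r:{0..s}|lborel. v' r \<omega> - v r \<omega>)"
          unfolding set_integral_diff(2)[OF i(4) i(2)] using elim s by auto
        have "(LINT r:{0..s}|lborel. - l * (u' r \<omega> - u r \<omega>) + m * (v' r \<omega> - v r \<omega>)) =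
            (LINT r:{0..s}|lborel. (- l * u' r \<omega> + m * v' r \<omega>) - (- l * u r \<omega> + m * v r \<omega>))"
          by (simp add: algebra_simps)
        also have "\<dots> = v' s \<omega> - v s \<omega>"
          unfolding set_integral_diff(2)[OF L[OF i(3,4)] L[OF i(1,2)]] using elim s by auto
        finally show "v' s \<omega> - v s \<omega> =
            (LINT r:{0..s}|lborel. - l * (u' r \<omega> - u r \<omega>) + m * (v' r \<omega> - v r \<omega>))" ..
      qed (rule t)
      then show "u' t \<omega> = u t \<omega>"
        by simp
    qed
  qed
qed

text \<open>The coordinates of two solutions agree almost surely, so both are mean-square limits of the same
  partial sums.\<close>

lemma generalized_solution_unique:
  fixes e :: "nat \<Rightarrow> 'x::{real_normed_vector, second_countable_topology}"
  assumes basis: "stochastic_basis M F"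
    and sol: "generalized_solution M F T e l m w U u v"
    and sol': "generalized_solution M F T e l m w U' u' v'"
    and t: "t \<in> {0..T}"
  shows "AE \<omega> in M. U' t \<omega> = U t \<omega>"
proof (rule mean_square_limit_unique)
  let ?S = "\<lambda>u n \<omega>. \<Sum>k<n. u k t \<omega> *\<^sub>R e k"
  have meas: "g \<in> borel_measurable M" if "g \<in> borel_measurable (F t)" for g :: "'a \<Rightarrow> 'c::topological_space"
    using stochastic_basisD(4)[OF basis _ that] t by auto
  have osc: "oscillator_solution M F T (l k) (m k) (w k) (u k) (v k)"
    "oscillator_solution M F T (l k) (m k) (w k) (u' k) (v' k)" for k
    using sol sol' by (auto simp: generalized_solution_def)
  have [measurable]: "u k t \<in> borel_measurable M" for k
    using osc(1)[of k] t by (intro meas) (auto simp: oscillator_solution_def adapted_on_def)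
  show "?S u n \<in> borel_measurable M" for n
    by measurable
  show "U t \<in> borel_measurable M" "U' t \<in> borel_measurable M"
    using sol sol' t by (auto intro!: meas simp: generalized_solution_def adapted_on_def)
  show "(\<lambda>n. \<integral>\<^sup>+\<omega>. ennreal ((norm (?S u n \<omega> - U t \<omega>))\<^sup>2) \<partial>M) \<longlonglongrightarrow> 0"
    using sol t by (auto simp: generalized_solution_def mean_square_expansion_def)
  have "AE \<omega> in M. u' k t \<omega> = u k t \<omega>" for k
    using oscillator_solution_unique[OF osc, of k] by eventually_elim (use t in blast)
  then have "AE \<omega> in M. \<forall>k. u' k t \<omega> = u k t \<omega>"
    by (simp add: AE_all_countable)
  then have "(\<integral>\<^sup>+\<omega>. ennreal ((norm (?S u n \<omega> - U' t \<omega>))\<^sup>2) \<partial>M) =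
      (\<integral>\<^sup>+\<omega>. ennreal ((norm (?S u' n \<omega> - U' t \<omega>))\<^sup>2) \<partial>M)" for n
    by (intro nn_integral_cong_AE) (auto elim!: eventually_mono)
  then show "(\<lambda>n. \<integral>\<^sup>+\<omega>. ennreal ((norm (?S u n \<omega> - U' t \<omega>))\<^sup>2) \<partial>M) \<longlonglongrightarrow> 0"
    using sol' t by (simp add: generalized_solution_def mean_square_expansion_def)
qed

theorem theorem2p4:
  fixes h :: "nat \<Rightarrow> 'h::{real_inner, polish_space}"
    and \<iota> :: "'h \<Rightarrow> 'x::{real_inner, polish_space}"
    and A0 A1 B0 B1 :: "'h operator"
    and \<kappa> \<tau> \<rho> \<nu> :: "nat \<Rightarrow> real"
    and \<Theta>1 \<Theta>2 :: "real set"
    and \<theta>1 \<theta>2 T :: real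
    and M :: "'w measure"
    and F :: "real \<Rightarrow> 'w measure"
    and w :: "nat \<Rightarrow> real \<Rightarrow> 'w \<Rightarrow> real"
  assumes "orthonormal_basis h"
    and "dense_embedding \<iota>"
    and "summable (\<lambda>k. (norm (\<iota> (h k)))\<^sup>2)"
    and "linear_operator A0" and "linear_operator A1"
    and "linear_operator B0" and "linear_operator B1"
    and "compact \<Theta>1" and "compact \<Theta>2"
    and "\<theta>1 \<in> \<Theta>1" and "\<theta>2 \<in> \<Theta>2"
    and "0 < T"
    and "stochastic_basis M F"
    and "independent_brownian_motions M F w"
    and "diagonalizable h A0 A1 B0 B1 \<kappa> \<tau> \<rho> \<nu>"
    and "hyperbolic T \<Theta>1 \<Theta>2 \<kappa> \<tau> \<rho> \<nu>"
  shows "\<exists>U u v.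
      generalized_solution M F T (\<lambda>k. \<iota> (h k)) (eig \<kappa> \<tau> \<theta>1) (eig \<rho> \<nu> \<theta>2) w U u v \<and>
      (\<forall>U' u' v'.
         generalized_solution M F T (\<lambda>k. \<iota> (h k)) (eig \<kappa> \<tau> \<theta>1) (eig \<rho> \<nu> \<theta>2) w U' u' v' \<longrightarrow>
         (\<forall>t\<in>{0..T}. AE \<omega> in M. U' t \<omega> = U t \<omega>)) \<and>
      ((\<exists>C0. \<forall>k. \<theta>2 * \<nu> k + \<rho> k \<le> C0) \<longrightarrow>
         (\<exists>V. adapted_on T F V \<and> mean_square_expansion M T (\<lambda>k. \<iota> (h k)) V v))"
proof -
  let ?l = "eig \<kappa> \<tau> \<theta>1" and ?m = "eig \<rho> \<nu> \<theta>2"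
  note basis = \<open>stochastic_basis M F\<close> and ind = \<open>independent_brownian_motions M F w\<close>
  note e = \<open>summable (\<lambda>k. (norm (\<iota> (h k)))\<^sup>2)\<close>
  note hyp = hyperbolicD[OF \<open>hyperbolic T \<Theta>1 \<Theta>2 \<kappa> \<tau> \<rho> \<nu>\<close> \<open>\<theta>1 \<in> \<Theta>1\<close> \<open>\<theta>2 \<in> \<Theta>2\<close>]
  have bm: "brownian_motion M F (w k)" for k
    using ind by (simp add: independent_brownian_motions_def)
  obtain f f' where ker: "\<And>k. oscillator_kernel (?l k) (?m k) (f k) (f' k)"
  proof -
    have "\<forall>k. \<exists>f f'. oscillator_kernel (?l k) (?m k) f f'"
      using oscillator_kernel_exists by blast
    from choice[OF this] obtain f where "\<forall>k. \<exists>f'. oscillator_kernel (?l k) (?m k) (f k) f'" ..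
    from choice[OF this] show ?thesis
      using that by blast
  qed
  define u where "u k = wiener_integral (f k) (w k)" for k
  define v where "v k = wiener_integral (f' k) (w k)" for k
  have adapted: "adapted_on T F (u k)" "adapted_on T F (v k)" for k
    unfolding u_def v_def by (intro wiener_integral_adapted[OF basis bm])+
  have lim: "AE \<omega> in M. stieltjes_sum (f k) (\<lambda>s. w k s \<omega>) t \<longlonglongrightarrow> u k t \<omega>"
    "AE \<omega> in M. stieltjes_sum (f' k) (\<lambda>s. w k s \<omega>) t \<longlonglongrightarrow> v k t \<omega>" if "t \<in> {0..T}" for k t
  proof -
    have "AE \<omega> in M. stieltjes_sum (f k) (\<lambda>s. w k s \<omega>) t \<longlonglongrightarrow> u k t \<omega> \<and>
        stieltjes_sum (f' k) (\<lambda>s. w k s \<omega>) t \<longlonglongrightarrow> v k t \<omega>"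
      unfolding u_def v_def using wiener_integral_path[OF ker[of k] bm[of k], of T]
      by eventually_elim (use that in blast)
    then show "AE \<omega> in M. stieltjes_sum (f k) (\<lambda>s. w k s \<omega>) t \<longlonglongrightarrow> u k t \<omega>"
      "AE \<omega> in M. stieltjes_sum (f' k) (\<lambda>s. w k s \<omega>) t \<longlonglongrightarrow> v k t \<omega>"
      by (auto elim: eventually_mono)
  qed
  obtain C where C: "\<forall>\<^sub>F k in sequentially. T * ?m k \<le> ln (?l k) + C"
    using hyp(2) by blast
  obtain B where B: "\<And>k s. s \<in> {0..T} \<Longrightarrow> (f k s)\<^sup>2 \<le> B"
    using hyperbolic_kernels_bounded[OF ker \<open>0 < T\<close> hyp(1) C] by blast
  obtain U where "adapted_on T F U" "mean_square_expansion M T (\<lambda>k. \<iota> (h k)) U u"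
    using mean_square_expansion_exists[OF basis ind e adapted(1) lim(1) B] by blast
  then have sol: "generalized_solution M F T (\<lambda>k. \<iota> (h k)) ?l ?m w U u v"
    using wiener_integral_oscillator_solution[OF ker basis bm]
    by (simp add: generalized_solution_def u_def v_def)
  show ?thesis
  proof (rule exI[of _ U], rule exI[of _ u], rule exI[of _ v], intro conjI allI impI ballI)
    show "generalized_solution M F T (\<lambda>k. \<iota> (h k)) ?l ?m w U u v"
      by (rule sol)
    show "AE \<omega> in M. U' t \<omega> = U t \<omega>"
      if "generalized_solution M F T (\<lambda>k. \<iota> (h k)) ?l ?m w U' u' v'" "t \<in> {0..T}" for U' u' v' t
      using generalized_solution_unique[OF basis sol that] .
    assume "\<exists>C0. \<forall>k. \<theta>2 * \<nu> k + \<rho> k \<le> C0"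
    then obtain C0 where "\<And>k. ?m k \<le> C0"
      by (auto simp: eig_def add.commute)
    then obtain B' where B': "\<And>k s. s \<in> {0..T} \<Longrightarrow> (f' k s)\<^sup>2 \<le> B'"
      using kernel_derivatives_bounded[OF ker hyp(1)] by blast
    show "\<exists>V. adapted_on T F V \<and> mean_square_expansion M T (\<lambda>k. \<iota> (h k)) V v"
      by (rule mean_square_expansion_exists[OF basis ind e adapted(2) lim(2) B'])
  qed
qed

end
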